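(* Let $\gamma\in(0,1)$, let $\alpha>\beta$ and $\tau>0$ be constants, and let $G_n\sim\mathrm{PDSM}(n,\mu_1,\mu_2,\tau^2)$ with $\mu_1=\alpha\sqrt{\frac{\log n}{n}}$, $\mu_2=\beta\sqrt{\frac{\log n}{n}}$ and planted labeling $\zeta^*\in\Theta_n^\gamma$; put $Z^*=\zeta^*\zeta^{*\top}$. Let $\mathrm{SNR}=\frac{(\alpha-\beta)^2}{8\tau^2}$. If $\gamma\,\mathrm{SNR}>1$, then $$\min_{Z^*\in\mathcal Z_n}\mathbb{P}\left[\hat Z_{\mathrm{SDP}}=Z^*\right]\to1\quad\text{as } n\to\infty .$$
   Context: $[n]=\{1,\dots,n\}$; $n$ ranges over positive integers for which $\gamma n$ is an integer; $\Theta_n^\gamma=\{\zeta\in\{0,1\}^n:\sum_i\zeta_i=\gamma n\}$. Gaussian weighted planted dense subgraph model $\mathrm{PDSM}(n,\mu_1,\mu_2,\tau^2)$ (with parameter $\gamma$): given a planted (unobserved) labeling $\zeta^*\in\Theta_n^\gamma$, the observed symmetric weighted adjacency matrix $A=(A_{ij})_{i,j\in[n]}$ has $A_{ii}=0$, and, independently over unordered pairs $\{i,j\}$ with $i\neq j$, $A_{ij}=A_{ji}\sim N(\mu_1,\tau^2)$ if $\zeta_i^*=\zeta_j^*=1$ and $A_{ij}=A_{ji}\sim N(\mu_2,\tau^2)$ otherwise. $\mathcal Z_n=\{\zeta\zeta^\top:\zeta\in\Theta_n^\gamma\}$; for $Z^*=\zeta^*\zeta^{*\top}\in\mathcal Z_n$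 the probability $\mathbb P[\hat Z_{\mathrm{SDP}}=Z^*]$ is computed under the model with planted labeling $\zeta^*$. $\langle X,Y\rangle=\mathrm{Tr}(X^\top Y)$, $\mathbf I$ is the $n\times n$ identity matrix and $\mathbf J$ the $n\times n$ all-ones matrix. The semidefinite programming estimator $\hat Z_{\mathrm{SDP}}$ is a maximizer of $\langle A,Z\rangle$ over symmetric real $n\times n$ matrices $Z$ with $Z\succeq0$, $Z_{ii}\le1$ for all $i\in[n]$, $Z_{ij}\ge0$ for all $i,j\in[n]$, $\langle\mathbf I,Z\rangle=\gamma n$, and $\langle\mathbf J,Z\rangle=\gamma^2n^2$. *)

theory Defs
  imports "HOL-Probability.Probability" "Jordan_Normal_Form.Matrix"
begin

(* Matrices and vectors are those of Jordan_Normal_Form, whose dimensions are values, so that n can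
   tend to infinity; the index set [n] = {1,...,n} becomes {0..<n}.  The HOL-Analysis notation for
   type-indexed vectors is switched off because it clashes. *)
unbundle no vec_syntax
hide_const (open) Finite_Cartesian_Product.vec Finite_Cartesian_Product.mat

definition admissible_sizes :: "real \<Rightarrow> nat set" where
  "admissible_sizes \<gamma> = {n. 0 < n \<and> \<gamma> * real n \<in> \<int>}"

definition labelings :: "nat \<Rightarrow> real \<Rightarrow> real vec set" where
  "labelings n \<gamma> =
     {\<zeta> \<in> carrier_vec n. (\<forall>i<n. \<zeta> $ i \<in> {0, 1}) \<and> (\<Sum>i<n. \<zeta> $ i) = \<gamma> * real n}"

definition outer_square :: "real vec \<Rightarrow> real mat" where
  "outer_square \<zeta> = mat (dim_vec \<zeta>) (dim_vec \<zeta>) (\<lambda>(i, j). \<zeta> $ i * \<zeta> $ j)"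

definition cluster_matrices :: "nat \<Rightarrow> real \<Rightarrow> real mat set" where
  "cluster_matrices n \<gamma> = outer_square ` labelings n \<gamma>"

(* The random matrix A on the probability space M is a draw from PDSM(n, \<mu>1, \<mu>2, \<tau>^2) with planted
   labeling \<zeta>.  The last parameter of normal_density is the standard deviation \<tau>, not the variance. *)
definition pdsm ::
  "'a measure \<Rightarrow> ('a \<Rightarrow> real mat) \<Rightarrow> nat \<Rightarrow> real \<Rightarrow> real \<Rightarrow> real \<Rightarrow> real vec \<Rightarrow> bool" where
  "pdsm M A n \<mu>1 \<mu>2 \<tau> \<zeta> \<longleftrightarrow>
     prob_space M \<and>
     (\<forall>\<omega>\<in>space M. A \<omega> \<in> carrier_mat n n \<and> transpose_mat (A \<omega>) = A \<omega> \<and> (\<forall>i<n. A \<omega> $$ (i, i) = 0)) \<and>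
     prob_space.indep_vars M (\<lambda>_. borel) (\<lambda>ij \<omega>. A \<omega> $$ ij) {(i, j). i < j \<and> j < n} \<and>
     (\<forall>i j. i < j \<and> j < n \<longrightarrow>
        distributed M lborel (\<lambda>\<omega>. A \<omega> $$ (i, j))
          (normal_density (if \<zeta> $ i = 1 \<and> \<zeta> $ j = 1 then \<mu>1 else \<mu>2) \<tau>))"

definition mat_trace :: "real mat \<Rightarrow> real" where
  "mat_trace X = (\<Sum>i<dim_row X. X $$ (i, i))"

definition mat_inner :: "real mat \<Rightarrow> real mat \<Rightarrow> real" where
  "mat_inner X Y = mat_trace (transpose_mat X * Y)"

definition all_ones_mat :: "nat \<Rightarrow> real mat" where
  "all_ones_mat n = mat n n (\<lambda>_. 1)"

definition psd_mat :: "nat \<Rightarrow> real mat \<Rightarrow> bool" where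
  "psd_mat n Z \<longleftrightarrow> (\<forall>v\<in>carrier_vec n. 0 \<le> v \<bullet> (Z *\<^sub>v v))"

definition sdp_feasible :: "nat \<Rightarrow> real \<Rightarrow> real mat \<Rightarrow> bool" where
  "sdp_feasible n \<gamma> Z \<longleftrightarrow>
     Z \<in> carrier_mat n n \<and> transpose_mat Z = Z \<and> psd_mat n Z \<and>
     (\<forall>i<n. Z $$ (i, i) \<le> 1) \<and> (\<forall>i<n. \<forall>j<n. 0 \<le> Z $$ (i, j)) \<and>
     mat_inner (1\<^sub>m n) Z = \<gamma> * real n \<and>
     mat_inner (all_ones_mat n) Z = \<gamma>\<^sup>2 * (real n)\<^sup>2"

(* The maximizer need not be unique: an SDP estimator is any function that selects one. *)
definition sdp_estimator :: "nat \<Rightarrow> real \<Rightarrow> (real mat \<Rightarrow> real mat) \<Rightarrow> bool" where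
  "sdp_estimator n \<gamma> Zhat \<longleftrightarrow>
     (\<forall>A\<in>carrier_mat n n. transpose_mat A = A \<longrightarrow>
        is_arg_max (mat_inner A) (sdp_feasible n \<gamma>) (Zhat A))"

definition snr :: "real \<Rightarrow> real \<Rightarrow> real \<Rightarrow> real" where
  "snr \<alpha> \<beta> \<tau> = (\<alpha> - \<beta>)\<^sup>2 / (8 * \<tau>\<^sup>2)"

end

theory Submission
  imports Defs "HOL-Real_Asymp.Real_Asymp"
begin

text \<open>Write \<open>C\<close> for the planted cluster, \<open>K = \<gamma>n\<close> for its size, \<open>Z\<^sup>*\<close> for the planted matrix,
\<open>g = sqrt (n ln n)\<close>, and \<open>W\<close> for the centred Gaussian noise (zero on the diagonal).

\<^emph>\<open>Optimality.\<close> Planted recovery follows from a dual certificate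
\<open>S = D - B - A + \<eta>I + \<lambda>J\<close> with \<open>D \<ge> 0\<close> diagonal and supported on \<open>C\<close>, \<open>B \<ge> 0\<close> entrywise and supported on
the pairs that join \<open>C\<close> to its complement, and \<open>S\<close> annihilating the indicator of \<open>C\<close>. The feasibility
constraints turn \<open>\<langle>S, Z\<rangle>\<close> into a lower bound: \<open>\<langle>S, Z\<rangle> \<le> \<langle>A, Z\<^sup>*\<rangle> - \<langle>A, Z\<rangle>\<close>. If \<open>S\<close> is positive definite
on the orthogonal complement of the indicator of \<open>C\<close>, then a feasible \<open>Z\<close> that does at least as well as \<open>Z\<^sup>*\<close>
is a multiple of \<open>Z\<^sup>*\<close>, and its trace makes it equal to \<open>Z\<^sup>*\<close>
(\<open>dual_certificate_forces_planted\<close>). The only fact about semidefinite matrices that enters is that they are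
Gram matrices (\<open>psd_gram_factorization\<close>), since then \<open>\<langle>S, Z\<rangle>\<close> is a sum of values of the form of \<open>S\<close>.

\<^emph>\<open>What the noise has to satisfy.\<close> Take \<open>\<lambda> = (\<mu>1 + \<mu>2) / 2\<close>. The sign conditions on \<open>D\<close> and \<open>B\<close> ask
that the noise in every row, summed over \<open>C\<close>, stay below half of the mean gap, which is
\<open>K (\<mu>1 - \<mu>2) / 2 = (\<gamma> (\<alpha> - \<beta>) / 2) g\<close>, with room for \<open>\<eta>\<close>; definiteness of \<open>S\<close> asks that \<open>\<eta>\<close> exceed the
norm of \<open>W\<close>, up to an additive constant (\<open>sdp_recovers_if_noise_small\<close>).

\<^emph>\<open>Why the noise satisfies it.\<close> A row sum is Gaussian with variance at most \<open>\<tau>\<^sup>2 \<gamma> n\<close>, so it exceeds \<open>a g\<close> in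
absolute value with probability at most \<open>2 n powr (- a\<^sup>2 / (2 \<tau>\<^sup>2 \<gamma>))\<close>. The union over \<open>n\<close> rows needs an exponent
above one, that is \<open>a > sqrt (2 \<tau>\<^sup>2 \<gamma>)\<close>; such an \<open>a\<close> below \<open>\<gamma> (\<alpha> - \<beta>) / 2\<close> exists precisely because
\<open>\<gamma> SNR > 1\<close>. The norm of \<open>W\<close> has the smaller order \<open>sqrt n\<close>, hence it is below any fixed
multiple of \<open>g\<close>: the quadratic form of \<open>W\<close> on the sphere of squared radius \<open>16n\<close> is controlled by its values
at integer points of the ball (\<open>quadratic_form_bound_from_net\<close>). There are only exponentially many such points
(\<open>lattice_net_card\<close>), and at each of them the Gaussian tail beyond a level
proportional to \<open>g\<close> is \<open>2 exp (- c n ln n)\<close>. Both estimates are instances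
of one Chernoff bound for linear forms in independent Gaussians (\<open>normal_linear_form_tail\<close>). They
depend on the labeling only through \<open>n\<close>, which makes the convergence uniform over the cluster matrices.\<close>

section \<open>Bilinear forms and squared norms on coordinates\<close>

lemma sum_indicator:
  fixes f :: "nat \<Rightarrow> real"
  assumes "C \<subseteq> {..<n}"
  shows "(\<Sum>i<n. of_bool (i \<in> C) * f i) = sum f C"
  using assms sum.inter_restrict[of "{..<n}" f C]
  by (simp add: Int_absorb1 of_bool_def if_distrib[of "\<lambda>x. x * _"] cong: if_cong)

text \<open>Matrices and vectors are plain functions, of which only the arguments below \<open>n\<close> matter. This makes induction on the
dimension and coordinatewise rounding direct.\<close>
definition bilin :: "nat \<Rightarrow> (nat \<Rightarrow> nat \<Rightarrow> real) \<Rightarrow> (nat \<Rightarrow> real) \<Rightarrow> (nat \<Rightarrow> real) \<Rightarrow> real" where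
  "bilin n W x y = (\<Sum>i<n. \<Sum>j<n. W i j * x i * y j)"

definition sqnorm :: "nat \<Rightarrow> (nat \<Rightarrow> real) \<Rightarrow> real" where
  "sqnorm n x = (\<Sum>i<n. (x i)\<^sup>2)"

lemma bilin_cong:
  assumes "\<And>i j. i < n \<Longrightarrow> j < n \<Longrightarrow> W i j = W' i j"
    and "\<And>i. i < n \<Longrightarrow> x i = x' i" and "\<And>i. i < n \<Longrightarrow> y i = y' i"
  shows "bilin n W x y = bilin n W' x' y'"
  unfolding bilin_def using assms by (intro sum.cong) auto

lemma bilin_add_left: "bilin n W (\<lambda>i. x i + x' i) y = bilin n W x y + bilin n W x' y"
  unfolding bilin_def by (simp add: algebra_simps sum.distrib)

lemma bilin_add_right: "bilin n W x (\<lambda>i. y i + y' i) = bilin n W x y + bilin n W x y'"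
  unfolding bilin_def by (simp add: algebra_simps sum.distrib)

lemma bilin_scale_left: "bilin n W (\<lambda>i. c * x i) y = c * bilin n W x y"
  unfolding bilin_def by (simp add: sum_distrib_left algebra_simps)

lemma bilin_scale_right: "bilin n W x (\<lambda>i. c * y i) = c * bilin n W x y"
  unfolding bilin_def by (simp add: sum_distrib_left algebra_simps)

lemma bilin_sym:
  assumes "\<And>i j. i < n \<Longrightarrow> j < n \<Longrightarrow> W i j = W j i"
  shows "bilin n W x y = bilin n W y x"
proof -
  have "bilin n W x y = (\<Sum>j<n. \<Sum>i<n. W i j * x i * y j)"
    unfolding bilin_def by (rule sum.swap)
  also have "\<dots> = bilin n W y x"
    unfolding bilin_def using assms by (intro sum.cong) (auto simp: algebra_simps)
  finally show ?thesis .
qed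

lemma sqnorm_nonneg: "0 \<le> sqnorm n x"
  unfolding sqnorm_def by (simp add: sum_nonneg)

lemma sqnorm_eq_0_iff: "sqnorm n x = 0 \<longleftrightarrow> (\<forall>i<n. x i = 0)"
  unfolding sqnorm_def by (subst sum_nonneg_eq_0_iff) auto

lemma sqnorm_scale: "sqnorm n (\<lambda>i. c * x i) = c\<^sup>2 * sqnorm n x"
  unfolding sqnorm_def by (simp add: power_mult_distrib sum_distrib_left)

lemma sqnorm_parallelogram:
  "sqnorm n (\<lambda>i. x i + y i) + sqnorm n (\<lambda>i. x i - y i) = 2 * (sqnorm n x + sqnorm n y)"
  unfolding sqnorm_def sum.distrib[symmetric] sum_distrib_left
  by (rule sum.cong) (auto simp: power2_eq_square algebra_simps)

lemma bilin_Suc: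
  assumes "\<And>i j. i < Suc n \<Longrightarrow> j < Suc n \<Longrightarrow> Z i j = Z j i"
  shows "bilin (Suc n) Z x x =
    bilin n Z x x + 2 * x n * (\<Sum>i<n. Z i n * x i) + Z n n * (x n)\<^sup>2"
proof -
  have "(\<Sum>j<n. Z n j * x n * x j) = x n * (\<Sum>i<n. Z i n * x i)"
    unfolding sum_distrib_left using assms by (intro sum.cong) (auto simp: algebra_simps)
  moreover have "(\<Sum>i<n. Z i n * x i * x n) = x n * (\<Sum>i<n. Z i n * x i)"
    unfolding sum_distrib_left by (intro sum.cong) (auto simp: algebra_simps)
  ultimately show ?thesis
    unfolding bilin_def by (simp add: sum.distrib power2_eq_square algebra_simps)
qed

section \<open>Positive semidefinite matrices are Gram matrices\<close>

text \<open>Induction on the dimension by Cholesky elimination of the last coordinate: subtracting the rank-one matrix built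
from the last column leaves a semidefinite form, because its value at \<open>x\<close> is the minimum of the original form over all
choices of the last coordinate. A zero pivot forces its whole column to vanish; the convention \<open>x / 0 = 0\<close>
then lets one formula serve both cases.\<close>
lemma psd_gram_factorization:
  assumes "\<And>i j. i < n \<Longrightarrow> j < n \<Longrightarrow> Z i j = Z j i"
    and "\<And>x. 0 \<le> bilin n Z x x"
  shows "\<exists>V. \<forall>i<n. \<forall>j<n. Z i j = (\<Sum>k<n. V k i * V k j)"
  using assms
proof (induction n arbitrary: Z)
  case 0
  then show ?case by simp
next
  case (Suc n)
  define c where "c = Z n n"
  define l where "l = (\<lambda>x::nat \<Rightarrow> real. \<Sum>i<n. Z i n * x i)"
  have psd: "0 \<le> bilin n Z x x + 2 * s * l x + c * s\<^sup>2" for x s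
  proof -
    have "bilin n Z (x(n := s)) (x(n := s)) = bilin n Z x x"
      by (rule bilin_cong) auto
    moreover have "(\<Sum>i<n. Z i n * (x(n := s)) i) = l x"
      unfolding l_def by (rule sum.cong) auto
    ultimately show ?thesis
      using Suc.prems(2)[of "x(n := s)"] bilin_Suc[of n Z "x(n := s)"] Suc.prems(1)
      by (simp add: c_def del: fun_upd_apply) (simp add: fun_upd_same)
  qed
  have "c \<ge> 0"
    using psd[of "\<lambda>_. 0" 1] by (simp add: bilin_def l_def)
  have pivot: "Z i n * Z n n / c = Z i n" if "i < Suc n" for i
  proof (cases "c = 0")
    case True
    define w where "w = (\<lambda>i. Z i n)"
    define q where "q = (\<Sum>i<n. (Z i n)\<^sup>2)"
    have lw: "l w = q" by (simp add: l_def w_def q_def power2_eq_square)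
    have "q \<ge> 0" by (simp add: q_def sum_nonneg)
    have "q = 0"
    proof (rule ccontr)
      assume "q \<noteq> 0"
      \<comment> \<open>with last coordinate -r, the form at w is its value on the first coordinates minus 2 q r, negative for large r\<close>
      then show False
        using psd[of w "- (bilin n Z w w + 1) / (2 * q)"] True lw by (simp add: field_simps)
    qed
    then have "i < n \<Longrightarrow> Z i n = 0"
      unfolding q_def by (subst (asm) sum_nonneg_eq_0_iff) auto
    then show ?thesis using True that c_def by (auto simp: less_Suc_eq)
  next
    case False
    then show ?thesis by (simp add: c_def)
  qed
  define Z' where "Z' = (\<lambda>i j. Z i j - Z i n * Z j n / c)"
  have "0 \<le> bilin n Z' x x" for x
  proof -
    have "bilin n Z' x x = bilin n Z x x - l x * l x / c"
      unfolding bilin_def Z'_def l_def sum_product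
      by (simp add: sum_subtractf sum_divide_distrib algebra_simps)
    \<comment> \<open>the original form at the minimizing last coordinate\<close>
    also have "\<dots> = bilin n Z x x + 2 * (- l x / c) * l x + c * (- l x / c)\<^sup>2"
      by (cases "c = 0") (auto simp: power2_eq_square field_simps)
    finally show ?thesis using psd[of x "- l x / c"] by simp
  qed
  moreover have "\<And>i j. i < n \<Longrightarrow> j < n \<Longrightarrow> Z' i j = Z' j i"
    using Suc.prems(1) by (simp add: Z'_def)
  ultimately obtain V where V: "\<forall>i<n. \<forall>j<n. Z' i j = (\<Sum>k<n. V k i * V k j)"
    using Suc.IH[of Z'] by blast
  define V' where "V' = (\<lambda>k i. if k < n then if i < n then V k i else 0 else Z i n / sqrt c)"
  have "Z i j = (\<Sum>k<Suc n. V' k i * V' k j)" if "i < Suc n" "j < Suc n" for i j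
  proof -
    have last: "V' n i * V' n j = Z i n * Z j n / c"
      using \<open>c \<ge> 0\<close> by (simp add: V'_def)
    consider "i < n" "j < n" | "i = n" | "j = n" using \<open>i < Suc n\<close> \<open>j < Suc n\<close> by (auto simp: less_Suc_eq)
    then show ?thesis
    proof cases
      case 1
      then have "(\<Sum>k<n. V' k i * V' k j) = Z' i j"
        using V by (simp add: V'_def)
      then show ?thesis using last by (simp add: Z'_def)
    next
      case 2
      then have "(\<Sum>k<n. V' k i * V' k j) = 0" by (simp add: V'_def)
      then show ?thesis
        using last 2 pivot[OF that(2)] Suc.prems(1)[OF that] by (simp add: mult.commute)
    next
      case 3
      then have "(\<Sum>k<n. V' k i * V' k j) = 0" by (simp add: V'_def)
      then show ?thesis using last 3 pivot[OF that(1)] by simp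
    qed
  qed
  then show ?case by blast
qed

section \<open>The dual certificate\<close>

text \<open>The certificate is \<open>S = D - B - A + eta I + lam J\<close>. The entries of \<open>B\<close> between an outside vertex and \<open>C\<close> depend on the
outside vertex only, so \<open>B\<close> disappears from the quadratic form on vectors that sum to zero over \<open>C\<close>, and \<open>D\<close> can only
help there: positivity of \<open>S\<close> reduces to the assumption on \<open>A\<close>. The values of \<open>D\<close> and \<open>B\<close> are determined by
requiring that \<open>S\<close> annihilate the indicator of \<open>C\<close>, and the row conditions say that they are nonnegative.\<close>
lemma dual_certificate_forces_planted:
  fixes A Z :: "nat \<Rightarrow> nat \<Rightarrow> real" and n :: nat and C :: "nat set" and lam eta :: real
  defines "K \<equiv> real (card C)"
  assumes C: "C \<subseteq> {..<n}" "C \<noteq> {}"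
    and symA: "\<And>i j. i < n \<Longrightarrow> j < n \<Longrightarrow> A i j = A j i"
    and inside: "\<And>i. i \<in> C \<Longrightarrow> eta + lam * K \<le> (\<Sum>j\<in>C. A i j)"
    and outside: "\<And>i. i < n \<Longrightarrow> i \<notin> C \<Longrightarrow> (\<Sum>j\<in>C. A i j) \<le> lam * K"
    and spec: "\<And>x. sum x C = 0 \<Longrightarrow> sqnorm n x > 0 \<Longrightarrow>
       bilin n A x x < eta * sqnorm n x + lam * (\<Sum>i<n. x i)\<^sup>2"
    and symZ: "\<And>i j. i < n \<Longrightarrow> j < n \<Longrightarrow> Z i j = Z j i"
    and psdZ: "\<And>x. 0 \<le> bilin n Z x x"
    and diagZ: "\<And>i. i < n \<Longrightarrow> Z i i \<le> 1"
    and nonnegZ: "\<And>i j. i < n \<Longrightarrow> j < n \<Longrightarrow> 0 \<le> Z i j"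
    and traceZ: "(\<Sum>i<n. Z i i) = K"
    and totalZ: "(\<Sum>i<n. \<Sum>j<n. Z i j) = K\<^sup>2"
    and better: "(\<Sum>i\<in>C. \<Sum>j\<in>C. A i j) \<le> (\<Sum>i<n. \<Sum>j<n. A i j * Z i j)"
    and "i < n" "j < n"
  shows "Z i j = of_bool (i \<in> C) * of_bool (j \<in> C)"
proof -
  have finC: "finite C" using C finite_subset by blast
  then have K: "K > 0" using C by (simp add: K_def card_gt_0_iff)
  note sumC = sum_indicator[OF C(1)]
  define r where "r = (\<lambda>i. \<Sum>j\<in>C. A i j)"
  define D where "D = (\<lambda>i. of_bool (i \<in> C) * (r i - eta - lam * K))"
  define b where "b = (\<lambda>i. of_bool (i \<notin> C) * (lam - r i / K))"
  define S where "S = (\<lambda>i j. of_bool (i = j) * (D i + eta)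
     - (b i * of_bool (j \<in> C) + of_bool (i \<in> C) * b j) - A i j + lam)"
  have D0: "D i \<ge> 0" for i using inside[of i] by (auto simp: D_def r_def algebra_simps)
  have b0: "b i \<ge> 0" if "i < n" for i
    using outside[OF that] K by (auto simp: b_def r_def field_simps)
  have delta: "(\<Sum>j<n. of_bool (i = j) * f i j) = f i i" if "i < n" for i and f :: "nat \<Rightarrow> nat \<Rightarrow> real"
    using that by (simp add: of_bool_def if_distrib[of "\<lambda>x. x * _"] cong: if_cong)
  have S_null: "(\<Sum>j<n. S i j * of_bool (j \<in> C)) = 0" if "i < n" for i
  proof -
    have "(\<Sum>j<n. S i j * of_bool (j \<in> C)) = (\<Sum>j\<in>C. S i j)"
      by (subst sumC[symmetric]) (simp add: mult.commute)
    also have "\<dots> = (\<Sum>j\<in>C. of_bool (i = j) * (D i + eta)) - (\<Sum>j\<in>C. b i + of_bool (i \<in> C) * b j)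
        - r i + lam * K"
      unfolding S_def r_def K_def by (simp add: sum.distrib sum_subtractf)
    also have "(\<Sum>j\<in>C. of_bool (i = j) * (D i + eta)) = of_bool (i \<in> C) * (D i + eta)"
      using finC by (simp add: of_bool_def if_distrib[of "\<lambda>x. x * _"] cong: if_cong)
    also have "(\<Sum>j\<in>C. b i + of_bool (i \<in> C) * b j) = K * b i"
      by (simp add: b_def K_def)
    finally show ?thesis
      using K by (cases "i \<in> C") (simp_all add: D_def b_def field_simps)
  qed
  have S_null': "bilin n S x (\<lambda>j. of_bool (j \<in> C)) = 0" for x
  proof -
    have "bilin n S x (\<lambda>j. of_bool (j \<in> C)) = (\<Sum>i<n. x i * (\<Sum>j<n. S i j * of_bool (j \<in> C)))"
      unfolding bilin_def sum_distrib_left by (intro sum.cong) (auto simp: algebra_simps)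
    then show ?thesis using S_null by simp
  qed
  have S_sym: "S i j = S j i" if "i < n" "j < n" for i j
    using symA[OF that] by (auto simp: S_def)
  have S_form: "bilin n S x x = (\<Sum>i<n. D i * (x i)\<^sup>2) + eta * sqnorm n x - bilin n A x x
      + lam * (\<Sum>i<n. x i)\<^sup>2" if "sum x C = 0" for x
  proof -
    have "bilin n S x x = (\<Sum>i<n. \<Sum>j<n. of_bool (i = j) * ((D i + eta) * x i * x j))
       - ((\<Sum>i<n. \<Sum>j<n. (b i * x i) * (of_bool (j \<in> C) * x j))
        + (\<Sum>i<n. \<Sum>j<n. (of_bool (i \<in> C) * x i) * (b j * x j)))
       - bilin n A x x + (\<Sum>i<n. \<Sum>j<n. lam * (x i * x j))"
      unfolding bilin_def S_def sum.distrib[symmetric] sum_subtractf[symmetric]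
      by (intro sum.cong refl) (simp add: algebra_simps)
    moreover have "(\<Sum>i<n. \<Sum>j<n. of_bool (i = j) * ((D i + eta) * x i * x j)) =
        (\<Sum>i<n. (D i + eta) * x i * x i)"
      by (intro sum.cong refl) (simp add: delta)
    moreover have "(\<Sum>i<n. \<Sum>j<n. (b i * x i) * (of_bool (j \<in> C) * x j)) = 0"
      unfolding sum_product[symmetric] sumC that by simp
    moreover have "(\<Sum>i<n. \<Sum>j<n. (of_bool (i \<in> C) * x i) * (b j * x j)) = 0"
      unfolding sum_product[symmetric] sumC that by simp
    moreover have "(\<Sum>i<n. \<Sum>j<n. lam * (x i * x j)) = lam * (\<Sum>i<n. x i)\<^sup>2"
      by (simp only: power2_eq_square sum_product) (simp only: sum_distrib_left)
    moreover have "(\<Sum>i<n. (D i + eta) * x i * x i) = (\<Sum>i<n. D i * (x i)\<^sup>2) + eta * sqnorm n x"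
      unfolding sqnorm_def sum_distrib_left sum.distrib[symmetric]
      by (intro sum.cong refl) (simp add: power2_eq_square algebra_simps)
    ultimately show ?thesis by simp
  qed
  have S_pos: "bilin n S x x > 0" if "sum x C = 0" "sqnorm n x > 0" for x
  proof -
    have "(\<Sum>i<n. D i * (x i)\<^sup>2) \<ge> 0" using D0 by (simp add: sum_nonneg)
    then show ?thesis using S_form[OF that(1)] spec[OF that] by linarith
  qed
  obtain V where V: "\<And>i j. i < n \<Longrightarrow> j < n \<Longrightarrow> Z i j = (\<Sum>k<n. V k i * V k j)"
    using psd_gram_factorization[of n Z] symZ psdZ by blast
  define a where "a = (\<lambda>k. sum (V k) C / K)"
  \<comment> \<open>the component of each Gram vector orthogonal to the indicator of C, which is all that S sees\<close>
  define w where "w = (\<lambda>k i. V k i + (- a k) * of_bool (i \<in> C))"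
  have w_orth: "sum (w k) C = 0" for k
    using K by (simp add: w_def a_def sum_subtractf K_def)
  have S_null'': "bilin n S (\<lambda>j. of_bool (j \<in> C)) x = 0" for x
    using S_null'[of x] bilin_sym[of n S, OF S_sym] by simp
  have V_w: "bilin n S (V k) (V k) = bilin n S (w k) (w k)" for k
    unfolding w_def bilin_add_left bilin_add_right bilin_scale_left bilin_scale_right S_null'
      S_null'' by simp
  have w_nonneg: "bilin n S (w k) (w k) \<ge> 0" for k
  proof (cases "sqnorm n (w k) = 0")
    case True
    then show ?thesis by (simp add: sqnorm_eq_0_iff bilin_def)
  next
    case False
    then show ?thesis using S_pos[OF w_orth, of k] sqnorm_nonneg[of n "w k"] by linarith
  qed
  \<comment> \<open>the pairing of S with Z is a sum of values of the form of S, hence nonnegative\<close>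
  have "(\<Sum>i<n. \<Sum>j<n. S i j * Z i j) = (\<Sum>i<n. \<Sum>j<n. \<Sum>k<n. S i j * V k i * V k j)"
    using V by (intro sum.cong) (auto simp: sum_distrib_left algebra_simps)
  also have "\<dots> = (\<Sum>i<n. \<Sum>k<n. \<Sum>j<n. S i j * V k i * V k j)"
    by (intro sum.cong refl sum.swap)
  also have "\<dots> = (\<Sum>k<n. bilin n S (V k) (V k))"
    unfolding bilin_def by (rule sum.swap)
  also have "\<dots> = (\<Sum>k<n. bilin n S (w k) (w k))"
    using V_w by simp
  finally have gram: "(\<Sum>i<n. \<Sum>j<n. S i j * Z i j) = (\<Sum>k<n. bilin n S (w k) (w k))" .
  \<comment> \<open>by the constraints on Z, the same pairing is at most the value of the planted matrix minus that of Z\<close>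
  have "(\<Sum>i<n. \<Sum>j<n. S i j * Z i j) = (\<Sum>i<n. \<Sum>j<n. of_bool (i = j) * ((D i + eta) * Z i j))
     - ((\<Sum>i<n. \<Sum>j<n. b i * of_bool (j \<in> C) * Z i j) + (\<Sum>i<n. \<Sum>j<n. of_bool (i \<in> C) * b j * Z i j))
     - (\<Sum>i<n. \<Sum>j<n. A i j * Z i j) + (\<Sum>i<n. \<Sum>j<n. lam * Z i j)"
    unfolding S_def sum.distrib[symmetric] sum_subtractf[symmetric]
    by (intro sum.cong refl) (simp add: algebra_simps)
  also have "(\<Sum>i<n. \<Sum>j<n. lam * Z i j) = lam * K\<^sup>2"
    by (simp add: sum_distrib_left[symmetric] totalZ)
  also have "(\<Sum>i<n. \<Sum>j<n. of_bool (i = j) * ((D i + eta) * Z i j)) = (\<Sum>i<n. D i * Z i i) + eta * K"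
    unfolding traceZ[symmetric] sum_distrib_left sum.distrib[symmetric]
    by (intro sum.cong refl) (simp add: delta distrib_right)
  also have "(\<Sum>i<n. D i * Z i i) + eta * K
     - ((\<Sum>i<n. \<Sum>j<n. b i * of_bool (j \<in> C) * Z i j) + (\<Sum>i<n. \<Sum>j<n. of_bool (i \<in> C) * b j * Z i j))
     - (\<Sum>i<n. \<Sum>j<n. A i j * Z i j) + lam * K\<^sup>2
     \<le> (\<Sum>i<n. D i) + eta * K - (\<Sum>i\<in>C. r i) + lam * K\<^sup>2"
  proof -
    have "(\<Sum>i<n. D i * Z i i) \<le> (\<Sum>i<n. D i)"
      using D0 diagZ by (intro sum_mono) (simp add: mult_left_le)
    moreover have "(\<Sum>i<n. \<Sum>j<n. b i * of_bool (j \<in> C) * Z i j) \<ge> 0"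
      using b0 nonnegZ by (intro sum_nonneg) auto
    moreover have "(\<Sum>i<n. \<Sum>j<n. of_bool (i \<in> C) * b j * Z i j) \<ge> 0"
      using b0 nonnegZ by (intro sum_nonneg) auto
    ultimately show ?thesis using better by (simp add: r_def)
  qed
  also have "(\<Sum>i<n. D i) = (\<Sum>i\<in>C. r i) - eta * K - lam * K\<^sup>2"
    unfolding D_def sumC by (simp add: sum_subtractf K_def power2_eq_square)
  finally have "(\<Sum>k<n. bilin n S (w k) (w k)) \<le> 0" using gram by simp
  then have "(\<Sum>k<n. bilin n S (w k) (w k)) = 0"
    using w_nonneg by (meson order_antisym sum_nonneg)
  then have "bilin n S (w k) (w k) = 0" if "k < n" for k
    using that w_nonneg by (subst (asm) sum_nonneg_eq_0_iff) auto
  then have "sqnorm n (w k) = 0" if "k < n" for k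
    using that S_pos[OF w_orth, of k] sqnorm_nonneg[of n "w k"] by fastforce
  then have V_eq: "V k i = a k * of_bool (i \<in> C)" if "k < n" "i < n" for k i
    using that by (force simp: sqnorm_eq_0_iff w_def)
  define c where "c = (\<Sum>k<n. (a k)\<^sup>2)"
  have Z_eq: "Z i j = c * (of_bool (i \<in> C) * of_bool (j \<in> C))" if "i < n" "j < n" for i j
    using that by (simp add: V V_eq c_def sum_distrib_right power2_eq_square algebra_simps)
  have "K = (\<Sum>i<n. of_bool (i \<in> C) * c)"
    unfolding traceZ[symmetric] by (intro sum.cong) (auto simp: Z_eq)
  then have "c = 1" using K unfolding sumC by (simp add: K_def)
  then show ?thesis using Z_eq[OF \<open>i < n\<close> \<open>j < n\<close>] by simp
qed

section \<open>Bounding a quadratic form by its values at integer points\<close>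

text \<open>Polarization: four times the bilinear form is the difference of the quadratic form at \<open>x + y\<close> and \<open>x - y\<close>.\<close>
lemma bilin_bound_polarized:
  assumes sym: "\<And>i j. i < n \<Longrightarrow> j < n \<Longrightarrow> W i j = W j i"
    and L: "\<And>x. \<bar>bilin n W x x\<bar> \<le> L * sqnorm n x"
  shows "\<bar>bilin n W x y\<bar> \<le> L / 2 * (sqnorm n x + sqnorm n y)"
proof -
  have "bilin n W (\<lambda>i. x i + y i) (\<lambda>i. x i + y i) - bilin n W (\<lambda>i. x i + (-1) * y i) (\<lambda>i. x i + (-1) * y i)
      = 4 * bilin n W x y"
    unfolding bilin_add_left bilin_add_right bilin_scale_left bilin_scale_right
    using bilin_sym[of n W y x, OF sym] by simp
  moreover have "\<bar>bilin n W (\<lambda>i. x i + y i) (\<lambda>i. x i + y i)\<bar> + \<bar>bilin n W (\<lambda>i. x i + (-1) * y i) (\<lambda>i. x i + (-1) * y i)\<bar>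
      \<le> L * (2 * (sqnorm n x + sqnorm n y))"
    using add_mono[OF L[of "\<lambda>i. x i + y i"] L[of "\<lambda>i. x i + (-1) * y i"]]
    unfolding sqnorm_parallelogram[symmetric] by (simp add: distrib_left)
  ultimately show ?thesis by (simp add: abs_if algebra_simps split: if_splits)
qed

text \<open>Integer vectors in the ball of squared radius \<open>16n\<close>. Rounding costs at most one per coordinate, that is a squared
distance of at most \<open>n\<close>, so relative to the radius the net has resolution one quarter.\<close>
definition lattice_net :: "nat \<Rightarrow> (nat \<Rightarrow> int) set" where
  "lattice_net n = {z \<in> {..<n} \<rightarrow>\<^sub>E UNIV. (\<Sum>i<n. (z i)\<^sup>2) \<le> int (16 * n)}"

text \<open>The net is counted through its \<open>l1\<close> norm, since a weight geometric in that norm factors into geometric series.\<close>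
lemma lattice_net_l1:
  assumes "z \<in> lattice_net n"
  shows "(\<Sum>i<n. \<bar>z i\<bar>) \<le> int (16 * n)"
proof -
  have "\<bar>m\<bar> \<le> m\<^sup>2" for m :: int
    using mult_right_mono[of 1 "\<bar>m\<bar>" "\<bar>m\<bar>"] by (cases "m = 0") (auto simp: power2_eq_square)
  then have "(\<Sum>i<n. \<bar>z i\<bar>) \<le> (\<Sum>i<n. (z i)\<^sup>2)" by (intro sum_mono)
  also have "\<dots> \<le> int (16 * n)" using assms by (simp add: lattice_net_def)
  finally show ?thesis .
qed

lemma sqnorm_lattice_net_le:
  assumes "z \<in> lattice_net n"
  shows "sqnorm n (\<lambda>i. real_of_int (z i)) \<le> 16 * real n"
proof -
  have "real_of_int (\<Sum>i<n. (z i)\<^sup>2) \<le> real_of_int (int (16 * n))"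
    using assms unfolding of_int_le_iff by (simp add: lattice_net_def)
  then show ?thesis by (simp add: sqnorm_def)
qed

lemma sum_half_powers: "(\<Sum>k\<in>{- int m..int m}. (1/2::real) ^ nat \<bar>k\<bar>) = 3 - 2 * (1/2) ^ m"
proof (induction m)
  case 0
  then show ?case by simp
next
  case (Suc m)
  have "{- int (Suc m)..int (Suc m)} = insert (- int (Suc m)) (insert (int (Suc m)) {- int m..int m})"
    by auto
  then show ?case using Suc by (simp add: nat_add_distrib)
qed

text \<open>Weight every integer vector \<open>z\<close> by \<open>(1/2)\<close> to the power of its \<open>l1\<close> norm. The total weight of a box factors over the
coordinates into sums below three, while each point of the net has weight at least \<open>(1/2) ^ (16 * n)\<close>.\<close>
lemma lattice_net_card:
  shows "finite (lattice_net n)" and "real (card (lattice_net n)) \<le> 2 ^ (16 * n) * 3 ^ n"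
proof -
  let ?box = "{..<n} \<rightarrow>\<^sub>E {- int (16 * n)..int (16 * n)}"
  have "lattice_net n \<subseteq> ?box"
  proof
    fix z assume z: "z \<in> lattice_net n"
    have "\<bar>z i\<bar> \<le> int (16 * n)" if "i < n" for i
    proof -
      have "\<bar>z i\<bar> \<le> (\<Sum>i<n. \<bar>z i\<bar>)"
        by (rule member_le_sum) (use that in auto)
      also have "\<dots> \<le> int (16 * n)" using z by (rule lattice_net_l1)
      finally show ?thesis .
    qed
    then show "z \<in> ?box"
      using z by (auto simp: lattice_net_def PiE_iff abs_le_iff minus_le_iff)
  qed
  moreover have fin: "finite ?box" by (simp add: finite_PiE)
  ultimately show "finite (lattice_net n)" by (rule finite_subset)
  let ?w = "\<lambda>z::nat \<Rightarrow> int. \<Prod>i<n. (1/2::real) ^ nat \<bar>z i\<bar>"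
  have w: "(1/2) ^ (16 * n) \<le> ?w z" if "z \<in> lattice_net n" for z
  proof -
    have "int (\<Sum>i<n. nat \<bar>z i\<bar>) \<le> int (16 * n)"
      using lattice_net_l1[OF that] by simp
    then have "(\<Sum>i<n. nat \<bar>z i\<bar>) \<le> 16 * n" by linarith
    then have "(1/2::real) ^ (16 * n) \<le> (1/2) ^ (\<Sum>i<n. nat \<bar>z i\<bar>)"
      by (intro power_decreasing) auto
    then show ?thesis by (simp add: power_sum)
  qed
  have "real (card (lattice_net n)) * (1/2) ^ (16 * n) = (\<Sum>z\<in>lattice_net n. (1/2) ^ (16 * n))"
    by simp
  also have "\<dots> \<le> (\<Sum>z\<in>lattice_net n. ?w z)" by (intro sum_mono) (use w in simp)
  also have "\<dots> \<le> (\<Sum>z\<in>?box. ?w z)"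
    by (rule sum_mono2) (use fin \<open>lattice_net n \<subseteq> ?box\<close> in \<open>auto intro!: prod_nonneg\<close>)
  also have "\<dots> = (\<Prod>i<n. \<Sum>k\<in>{- int (16 * n)..int (16 * n)}. (1/2::real) ^ nat \<bar>k\<bar>)"
    using prod_sum_PiE[of "{..<n}" "\<lambda>_. {- int (16 * n)..int (16 * n)}" "\<lambda>_ k. (1/2::real) ^ nat \<bar>k\<bar>"]
    by simp
  also have "\<dots> \<le> (\<Prod>i<n. 3)"
    unfolding sum_half_powers by (intro prod_mono)
       (use power_le_one[of "1/2::real" "16 * n"] in \<open>auto simp del: power_mult\<close>)
  finally show "real (card (lattice_net n)) \<le> 2 ^ (16 * n) * 3 ^ n"
    by (simp add: field_simps)
qed

lemma ex_int_rounded_to_zero: "\<exists>k::int. \<bar>real_of_int k\<bar> \<le> \<bar>y\<bar> \<and> \<bar>y - real_of_int k\<bar> \<le> 1"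
proof (cases "0 \<le> y")
  case True
  then show ?thesis by (intro exI[of _ "\<lfloor>y\<rfloor>"] conjI; simp; linarith)
next
  case False
  then have "real_of_int \<lceil>y\<rceil> \<le> 0" by simp
  then show ?thesis
    using ceiling_correct[of y] False by (intro exI[of _ "\<lceil>y\<rceil>"] conjI) linarith+
qed

text \<open>Rounding towards zero does not increase any coordinate, so the rounded point stays in the ball.\<close>
lemma lattice_net_approx:
  assumes "sqnorm n x = 16 * real n"
  obtains z where "z \<in> lattice_net n" "sqnorm n (\<lambda>i. real_of_int (z i)) \<le> 16 * real n"
    "sqnorm n (\<lambda>i. x i - real_of_int (z i)) \<le> real n"
proof -
  obtain k :: "nat \<Rightarrow> int" where k: "\<And>i. \<bar>real_of_int (k i)\<bar> \<le> \<bar>x i\<bar>" "\<And>i. \<bar>x i - real_of_int (k i)\<bar> \<le> 1"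
    using choice[of "\<lambda>i k. \<bar>real_of_int k\<bar> \<le> \<bar>x i\<bar> \<and> \<bar>x i - real_of_int k\<bar> \<le> 1"]
      ex_int_rounded_to_zero by blast
  define z where "z = restrict k {..<n}"
  have *: "sqnorm n (\<lambda>i. real_of_int (z i)) \<le> 16 * real n"
    unfolding assms[symmetric] sqnorm_def z_def using k(1)
    by (intro sum_mono) (auto simp: abs_le_square_iff)
  then have "real_of_int (\<Sum>i<n. (z i)\<^sup>2) \<le> real_of_int (int (16 * n))"
    by (simp add: sqnorm_def)
  then have "(\<Sum>i<n. (z i)\<^sup>2) \<le> int (16 * n)" by (simp only: of_int_le_iff)
  then have "z \<in> lattice_net n" by (simp add: lattice_net_def z_def)
  moreover have "sqnorm n (\<lambda>i. x i - real_of_int (z i)) \<le> (\<Sum>i<n. 1)"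
    unfolding sqnorm_def z_def using k(2) by (intro sum_mono) (auto simp: abs_square_le_1)
  ultimately show ?thesis using that * by simp
qed

text \<open>If \<open>L\<close> bounds the form relative to the squared norm, then moving from a point of the sphere to the net changes
the form by at most half of \<open>L\<close>, so \<open>t + L / 2\<close> is also a bound. Applied to the least bound, this gives
\<open>L \<le> 2 * t\<close>.\<close>
lemma quadratic_form_bound_from_net:
  assumes sym: "\<And>i j. i < n \<Longrightarrow> j < n \<Longrightarrow> W i j = W j i"
    and net: "\<And>z. z \<in> lattice_net n \<Longrightarrow>
      \<bar>bilin n W (\<lambda>i. real_of_int (z i)) (\<lambda>i. real_of_int (z i))\<bar> \<le> t * (16 * real n)"
  shows "\<bar>bilin n W x x\<bar> \<le> 2 * t * sqnorm n x"
proof (cases "n = 0")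
  case True
  then show ?thesis by (simp add: bilin_def sqnorm_def)
next
  case False
  define B where "B = {L. \<forall>x. \<bar>bilin n W x x\<bar> \<le> L * sqnorm n x}"
  have improve: "t + L / 2 \<in> B" if "L \<in> B" for L
  proof -
    have L: "\<bar>bilin n W x x\<bar> \<le> L * sqnorm n x" for x using that by (simp add: B_def)
    have sphere: "\<bar>bilin n W y y\<bar> \<le> (t + L / 2) * (16 * real n)" if y: "sqnorm n y = 16 * real n" for y
    proof -
      obtain z where z: "z \<in> lattice_net n" "sqnorm n (\<lambda>i. real_of_int (z i)) \<le> 16 * real n"
        "sqnorm n (\<lambda>i. y i - real_of_int (z i)) \<le> real n"
        using lattice_net_approx[OF y] .
      let ?z = "\<lambda>i. real_of_int (z i)"
      let ?d = "\<lambda>i. y i + (-1) * ?z i" and ?s = "\<lambda>i. y i + ?z i"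
      have "bilin n W ?s ?d = bilin n W y y - bilin n W ?z ?z"
        unfolding bilin_add_left bilin_add_right bilin_scale_right
        using bilin_sym[of n W y ?z, OF sym] by simp
      \<comment> \<open>the sum and the difference differ in length by a factor of eight; balancing them makes the polarized bound sharp\<close>
      moreover have "bilin n W ?s ?d = 8 * bilin n W (\<lambda>i. (1/8) * ?s i) ?d"
        unfolding bilin_scale_left by simp
      moreover have "L \<ge> 0"
        using order_trans[OF abs_ge_zero L[of y]] y False by (simp add: zero_le_mult_iff)
      moreover have "sqnorm n (\<lambda>i. (1/8) * ?s i) \<le> real n"
        using sqnorm_parallelogram[of n y ?z] y z(2) sqnorm_nonneg[of n "\<lambda>i. y i - ?z i"]
        unfolding sqnorm_scale by (simp add: power2_eq_square)
      moreover have "\<bar>bilin n W (\<lambda>i. (1/8) * ?s i) ?d\<bar> \<le>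
          L / 2 * (sqnorm n (\<lambda>i. (1/8) * ?s i) + sqnorm n ?d)"
        by (rule bilin_bound_polarized[OF sym L])
      moreover from calculation(3,4) z(3) have "L / 2 * (sqnorm n (\<lambda>i. (1/8) * ?s i) + sqnorm n ?d)
          \<le> L / 2 * (real n + real n)"
        by (intro mult_left_mono add_mono) auto
      ultimately have "\<bar>bilin n W (\<lambda>i. (1/8) * ?s i) ?d\<bar> \<le> L / 2 * (real n + real n)"
        by linarith
      moreover have "(t + L / 2) * (16 * real n) = t * (16 * real n) + 8 * (L / 2 * (real n + real n))"
        by (simp add: algebra_simps)
      ultimately show ?thesis
        using net[OF z(1)] \<open>bilin n W ?s ?d = bilin n W y y - _\<close> \<open>bilin n W ?s ?d = 8 * _\<close>
        by linarith
    qed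
    have "\<bar>bilin n W x x\<bar> \<le> (t + L / 2) * sqnorm n x" for x
    proof (cases "sqnorm n x = 0")
      case True
      then have "bilin n W x x = 0"
        unfolding bilin_def by (intro sum.neutral) (auto simp: sqnorm_eq_0_iff)
      then show ?thesis using True by simp
    next
      case nz: False
      then have pos: "sqnorm n x > 0" using sqnorm_nonneg[of n x] by linarith
      define c where "c = sqrt (16 * real n / sqnorm n x)"
      have c2: "c\<^sup>2 * sqnorm n x = 16 * real n" "c\<^sup>2 > 0" using pos False by (auto simp: c_def)
      have "c\<^sup>2 * \<bar>bilin n W x x\<bar> = \<bar>bilin n W (\<lambda>i. c * x i) (\<lambda>i. c * x i)\<bar>"
        unfolding bilin_scale_left bilin_scale_right by (simp add: abs_mult power2_eq_square)
      also have "\<dots> \<le> (t + L / 2) * (16 * real n)"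
        by (rule sphere) (simp add: sqnorm_scale c2)
      also have "\<dots> = c\<^sup>2 * ((t + L / 2) * sqnorm n x)"
        unfolding c2(1)[symmetric] by simp
      finally show ?thesis using c2(2) by (subst (asm) mult_le_cancel_left_pos)
    qed
    then show ?thesis by (simp add: B_def)
  qed
  have nonneg: "L \<ge> 0" if "L \<in> B" for L
  proof -
    have "0 \<le> L * sqnorm n (\<lambda>_. 1)"
      using that order_trans[OF abs_ge_zero] unfolding B_def by blast
    then show ?thesis using False by (simp add: sqnorm_def zero_le_mult_iff)
  qed
  have "B \<noteq> {}"
  proof -
    have "\<bar>bilin n W x x\<bar> \<le> (\<Sum>i<n. \<Sum>j<n. \<bar>W i j\<bar>) * sqnorm n x" for x
    proof -
      have prod_le: "\<bar>x i * x j\<bar> \<le> sqnorm n x" if "i < n" "j < n" for i j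
      proof -
        have "(x i)\<^sup>2 \<le> sqnorm n x" "(x j)\<^sup>2 \<le> sqnorm n x"
          unfolding sqnorm_def using that by (auto intro: member_le_sum)
        then show ?thesis
          using sum_squares_bound[of "x i" "x j"] sum_squares_bound[of "x i" "- x j"]
          by (simp add: abs_if power2_eq_square)
      qed
      have "\<bar>bilin n W x x\<bar> \<le> (\<Sum>i<n. \<Sum>j<n. \<bar>W i j * x i * x j\<bar>)"
        unfolding bilin_def by (intro order_trans[OF sum_abs] sum_mono sum_abs)
      also have "\<dots> \<le> (\<Sum>i<n. \<Sum>j<n. \<bar>W i j\<bar> * sqnorm n x)"
        using prod_le by (intro sum_mono) (simp add: abs_mult mult.assoc mult_left_mono)
      finally show ?thesis by (simp add: sum_distrib_right)
    qed
    then show ?thesis unfolding B_def by blast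
  qed
  define I where "I = Inf B"
  have "bdd_below B" using nonneg by (rule bdd_belowI)
  have I_le: "I \<le> L" if "L \<in> B" for L
    unfolding I_def using that \<open>bdd_below B\<close> by (rule cInf_lower)
  have "I \<le> t + I / 2"
  proof (rule field_le_epsilon)
    fix e :: real assume "e > 0"
    then have "\<exists>L\<in>B. L < I + e"
      using cInf_lessD[OF \<open>B \<noteq> {}\<close>, of "I + e"] by (simp add: I_def)
    then obtain L where "L \<in> B" "L < I + e" by blast
    then show "I \<le> t + I / 2 + e" using I_le[OF improve[OF \<open>L \<in> B\<close>]] \<open>e > 0\<close> by simp
  qed
  then have "I \<le> 2 * t" by simp
  have "\<bar>bilin n W x x\<bar> \<le> I * sqnorm n x"
  proof (rule field_le_epsilon)
    fix e :: real assume "e > 0"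
    define e' where "e' = e / (sqnorm n x + 1)"
    have "e' > 0" using \<open>e > 0\<close> sqnorm_nonneg[of n x] by (simp add: e'_def)
    then have "\<exists>L\<in>B. L < I + e'"
      using cInf_lessD[OF \<open>B \<noteq> {}\<close>, of "I + e'"] by (simp add: I_def)
    then obtain L where L: "L \<in> B" "L < I + e'" by blast
    then have "\<bar>bilin n W x x\<bar> \<le> L * sqnorm n x" by (simp add: B_def)
    also have "\<dots> \<le> (I + e') * sqnorm n x" using L sqnorm_nonneg by (intro mult_right_mono) auto
    also have "\<dots> = I * sqnorm n x + e' * sqnorm n x" by (rule distrib_right)
    also have "\<dots> \<le> I * sqnorm n x + e"
      using \<open>e > 0\<close> sqnorm_nonneg[of n x] by (simp add: e'_def field_simps)
    finally show "\<bar>bilin n W x x\<bar> \<le> I * sqnorm n x + e" .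
  qed
  also have "\<dots> \<le> 2 * t * sqnorm n x"
    using \<open>I \<le> 2 * t\<close> sqnorm_nonneg by (rule mult_right_mono)
  finally show ?thesis .
qed

section \<open>Gaussian linear forms\<close>

text \<open>Completing the square: exponential tilting of a normal density shifts its mean and multiplies it by the moment
generating function.\<close>
lemma nn_integral_exp_normal:
  assumes "0 < \<sigma>"
  shows "(\<integral>\<^sup>+x. ennreal (normal_density \<mu> \<sigma> x) * ennreal (exp (s * (x - \<mu>))) \<partial>lborel)
    = ennreal (exp (s\<^sup>2 * \<sigma>\<^sup>2 / 2))"
proof -
  have tilt: "normal_density \<mu> \<sigma> x * exp (s * (x - \<mu>))
      = exp (s\<^sup>2 * \<sigma>\<^sup>2 / 2) * normal_density (\<mu> + s * \<sigma>\<^sup>2) \<sigma> x" for x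
  proof -
    have "- (x - \<mu>)\<^sup>2 / (2 * \<sigma>\<^sup>2) + s * (x - \<mu>)
        = s\<^sup>2 * \<sigma>\<^sup>2 / 2 + - (x - (\<mu> + s * \<sigma>\<^sup>2))\<^sup>2 / (2 * \<sigma>\<^sup>2)"
      using assms by (simp add: field_simps power2_eq_square)
    then have "exp (- (x - \<mu>)\<^sup>2 / (2 * \<sigma>\<^sup>2)) * exp (s * (x - \<mu>))
        = exp (s\<^sup>2 * \<sigma>\<^sup>2 / 2) * exp (- (x - (\<mu> + s * \<sigma>\<^sup>2))\<^sup>2 / (2 * \<sigma>\<^sup>2))"
      by (simp only: exp_add[symmetric])
    then show ?thesis by (simp add: normal_density_def mult_ac)
  qed
  have "(\<integral>\<^sup>+x. ennreal (normal_density \<mu> \<sigma> x) * ennreal (exp (s * (x - \<mu>))) \<partial>lborel)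
    = (\<integral>\<^sup>+x. ennreal (exp (s\<^sup>2 * \<sigma>\<^sup>2 / 2)) * ennreal (normal_density (\<mu> + s * \<sigma>\<^sup>2) \<sigma> x) \<partial>lborel)"
    by (intro nn_integral_cong) (simp add: ennreal_mult[symmetric] tilt)
  also have "\<dots> = ennreal (exp (s\<^sup>2 * \<sigma>\<^sup>2 / 2)) *
      (\<integral>\<^sup>+x. ennreal (normal_density (\<mu> + s * \<sigma>\<^sup>2) \<sigma> x) \<partial>lborel)"
    by (intro nn_integral_cmult) auto
  also have "(\<integral>\<^sup>+x. ennreal (normal_density (\<mu> + s * \<sigma>\<^sup>2) \<sigma> x) \<partial>lborel) = 1"
    using assms by (subst nn_integral_eq_integral) auto
  finally show ?thesis by simp
qed

text \<open>Chernoff bound. By independence, the exponential moment of the sum is the product of the individual ones, so only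
\<open>\<Sum>i\<in>I. (c i)\<^sup>2\<close> matters.\<close>
lemma (in prob_space) normal_linear_form_tail:
  fixes X :: "'i \<Rightarrow> 'a \<Rightarrow> real"
  assumes fin: "finite I" and indep: "indep_vars (\<lambda>_. borel) X I"
    and normal: "\<And>i. i \<in> I \<Longrightarrow> distributed M lborel (X i) (normal_density (\<mu> i) \<sigma>)"
    and "0 < \<sigma>" and V: "(\<Sum>i\<in>I. (c i)\<^sup>2) \<le> V" "0 < V" and "0 < t"
  shows "prob {\<omega>\<in>space M. t \<le> (\<Sum>i\<in>I. c i * (X i \<omega> - \<mu> i))} \<le> exp (- t\<^sup>2 / (2 * \<sigma>\<^sup>2 * V))"
proof -
  \<comment> \<open>the minimizer of the exponent s^2 \<sigma>^2 V / 2 - s t\<close>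
  define s where "s = t / (\<sigma>\<^sup>2 * V)"
  have s: "s > 0" using assms by (simp add: s_def)
  have [measurable]: "i \<in> I \<Longrightarrow> X i \<in> borel_measurable M" for i
    using indep by (auto simp: indep_vars_def)
  let ?S = "\<lambda>\<omega>. \<Sum>i\<in>I. c i * (X i \<omega> - \<mu> i)"
  have "ennreal (prob {\<omega>\<in>space M. t \<le> ?S \<omega>}) = emeasure M {\<omega>\<in>space M. t \<le> ?S \<omega>}"
    by (simp add: emeasure_eq_measure)
  also have "\<dots> \<le> ennreal (exp (- s * t)) * (\<integral>\<^sup>+\<omega>\<in>space M. exp (s * ?S \<omega>) \<partial>M)"
    by (intro Chernoff_ineq_nn_integral_ge s) auto
  also have "(\<integral>\<^sup>+\<omega>\<in>space M. exp (s * ?S \<omega>) \<partial>M)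
      = (\<integral>\<^sup>+\<omega>. (\<Prod>i\<in>I. ennreal (exp (s * c i * (X i \<omega> - \<mu> i)))) \<partial>M)"
    by (intro nn_integral_cong)
       (simp_all add: sum_distrib_left exp_sum fin prod_ennreal mult.assoc)
  also have "\<dots> = (\<Prod>i\<in>I. \<integral>\<^sup>+\<omega>. ennreal (exp (s * c i * (X i \<omega> - \<mu> i))) \<partial>M)"
    by (intro indep_vars_nn_integral fin indep_vars_compose2[OF indep]) auto
  also have "\<dots> = (\<Prod>i\<in>I. ennreal (exp ((s * c i)\<^sup>2 * \<sigma>\<^sup>2 / 2)))"
  proof (intro prod.cong refl)
    fix i assume "i \<in> I"
    have "(\<integral>\<^sup>+\<omega>. ennreal (exp (s * c i * (X i \<omega> - \<mu> i))) \<partial>M)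
      = (\<integral>\<^sup>+x. ennreal (normal_density (\<mu> i) \<sigma> x) * ennreal (exp (s * c i * (x - \<mu> i))) \<partial>lborel)"
      by (rule distributed_nn_integral[OF normal[OF \<open>i \<in> I\<close>], symmetric]) auto
    then show "(\<integral>\<^sup>+\<omega>. ennreal (exp (s * c i * (X i \<omega> - \<mu> i))) \<partial>M) = ennreal (exp ((s * c i)\<^sup>2 * \<sigma>\<^sup>2 / 2))"
      by (simp only: nn_integral_exp_normal[OF \<open>0 < \<sigma>\<close>])
  qed
  also have "\<dots> = ennreal (exp (s\<^sup>2 * \<sigma>\<^sup>2 / 2 * (\<Sum>i\<in>I. (c i)\<^sup>2)))"
    by (simp add: prod_ennreal exp_sum[symmetric] fin sum_distrib_left power_mult_distrib mult_ac)
  finally have "ennreal (prob {\<omega>\<in>space M. t \<le> ?S \<omega>})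
      \<le> ennreal (exp (- s * t) * exp (s\<^sup>2 * \<sigma>\<^sup>2 / 2 * (\<Sum>i\<in>I. (c i)\<^sup>2)))"
    by (simp add: ennreal_mult)
  then have "prob {\<omega>\<in>space M. t \<le> ?S \<omega>} \<le> exp (- s * t) * exp (s\<^sup>2 * \<sigma>\<^sup>2 / 2 * (\<Sum>i\<in>I. (c i)\<^sup>2))"
    by (subst (asm) ennreal_le_iff) auto
  also have "\<dots> = exp (- s * t + s\<^sup>2 * \<sigma>\<^sup>2 / 2 * (\<Sum>i\<in>I. (c i)\<^sup>2))"
    by (rule exp_add[symmetric])
  also have "\<dots> \<le> exp (- s * t + s\<^sup>2 * \<sigma>\<^sup>2 / 2 * V)"
    using V(1) by (simp add: mult_left_mono)
  also have "- s * t + s\<^sup>2 * \<sigma>\<^sup>2 / 2 * V = - t\<^sup>2 / (2 * \<sigma>\<^sup>2 * V)"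
    using \<open>0 < \<sigma>\<close> V(2) by (simp add: s_def field_simps power2_eq_square)
  finally show ?thesis .
qed

lemma (in prob_space) normal_linear_form_abs_tail:
  fixes X :: "'i \<Rightarrow> 'a \<Rightarrow> real"
  assumes fin: "finite I" and indep: "indep_vars (\<lambda>_. borel) X I"
    and normal: "\<And>i. i \<in> I \<Longrightarrow> distributed M lborel (X i) (normal_density (\<mu> i) \<sigma>)"
    and "0 < \<sigma>" and V: "(\<Sum>i\<in>I. (c i)\<^sup>2) \<le> V" "0 < V" and "0 < t"
  shows "{\<omega>\<in>space M. t \<le> \<bar>\<Sum>i\<in>I. c i * (X i \<omega> - \<mu> i)\<bar>} \<in> events"
    and "prob {\<omega>\<in>space M. t \<le> \<bar>\<Sum>i\<in>I. c i * (X i \<omega> - \<mu> i)\<bar>} \<le> 2 * exp (- t\<^sup>2 / (2 * \<sigma>\<^sup>2 * V))"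
proof -
  have [measurable]: "i \<in> I \<Longrightarrow> X i \<in> borel_measurable M" for i
    using indep by (auto simp: indep_vars_def)
  show "{\<omega>\<in>space M. t \<le> \<bar>\<Sum>i\<in>I. c i * (X i \<omega> - \<mu> i)\<bar>} \<in> events" by measurable
  let ?P = "{\<omega>\<in>space M. t \<le> (\<Sum>i\<in>I. c i * (X i \<omega> - \<mu> i))}"
  let ?N = "{\<omega>\<in>space M. t \<le> (\<Sum>i\<in>I. (- c i) * (X i \<omega> - \<mu> i))}"
  have "{\<omega>\<in>space M. t \<le> \<bar>\<Sum>i\<in>I. c i * (X i \<omega> - \<mu> i)\<bar>} = ?P \<union> ?N"
    by (auto simp: sum_negf)
  moreover have "prob (?P \<union> ?N) \<le> prob ?P + prob ?N"
    by (rule measure_Un_le) measurable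
  moreover have "prob ?P \<le> exp (- t\<^sup>2 / (2 * \<sigma>\<^sup>2 * V))"
    by (rule normal_linear_form_tail[OF assms])
  moreover have "prob ?N \<le> exp (- t\<^sup>2 / (2 * \<sigma>\<^sup>2 * V))"
    by (rule normal_linear_form_tail) (use assms in auto)
  ultimately show "prob {\<omega>\<in>space M. t \<le> \<bar>\<Sum>i\<in>I. c i * (X i \<omega> - \<mu> i)\<bar>}
      \<le> 2 * exp (- t\<^sup>2 / (2 * \<sigma>\<^sup>2 * V))" by simp
qed

section \<open>Noise conditions that make the planted matrix the unique maximizer\<close>

definition upper_pairs :: "nat \<Rightarrow> (nat \<times> nat) set" where
  "upper_pairs n = {(i, j). i < j \<and> j < n}"

lemma finite_upper_pairs: "finite (upper_pairs n)"
  by (rule finite_subset[of _ "{..<n} \<times> {..<n}"]) (auto simp: upper_pairs_def)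

text \<open>The independent entries of a symmetric random matrix are those above the diagonal; this turns a form over all index
pairs into a linear form in the independent entries.\<close>
lemma sum_square_upper_pairs:
  fixes f :: "nat \<Rightarrow> nat \<Rightarrow> real"
  shows "(\<Sum>i<n. \<Sum>j<n. f i j) = (\<Sum>i<n. f i i) + (\<Sum>(i, j)\<in>upper_pairs n. f i j + f j i)"
proof (induction n)
  case 0
  then show ?case by (simp add: upper_pairs_def)
next
  case (Suc n)
  have "upper_pairs (Suc n) = upper_pairs n \<union> (\<lambda>i. (i, n)) ` {..<n}"
    by (auto simp: upper_pairs_def less_Suc_eq)
  moreover have "(\<Sum>(i, j)\<in>upper_pairs n \<union> (\<lambda>i. (i, n)) ` {..<n}. f i j + f j i)
      = (\<Sum>(i, j)\<in>upper_pairs n. f i j + f j i) + (\<Sum>(i, j)\<in>(\<lambda>i. (i, n)) ` {..<n}. f i j + f j i)"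
    by (intro sum.union_disjoint finite_upper_pairs) (auto simp: upper_pairs_def)
  moreover have "(\<Sum>(i, j)\<in>(\<lambda>i. (i, n)) ` {..<n}. f i j + f j i) = (\<Sum>i<n. f i n + f n i)"
    by (subst sum.reindex) (auto simp: inj_on_def)
  ultimately show ?case using Suc by (simp add: sum.distrib)
qed

lemma mat_inner_eq_sum:
  assumes "X \<in> carrier_mat n n" "Y \<in> carrier_mat n n"
  shows "mat_inner X Y = (\<Sum>i<n. \<Sum>j<n. X $$ (i, j) * Y $$ (i, j))"
proof -
  have "mat_inner X Y = (\<Sum>j<n. \<Sum>i<n. X $$ (i, j) * Y $$ (i, j))"
    unfolding mat_inner_def mat_trace_def using assms
    by (intro sum.cong) (auto simp: scalar_prod_def atLeast0LessThan)
  then show ?thesis by (subst sum.swap)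
qed

lemma quadratic_form_eq_bilin:
  assumes "X \<in> carrier_mat n n" "v \<in> carrier_vec n"
  shows "v \<bullet> (X *\<^sub>v v) = bilin n (\<lambda>i j. X $$ (i, j)) (\<lambda>i. v $ i) (\<lambda>i. v $ i)"
  using assms by (simp add: scalar_prod_def bilin_def atLeast0LessThan sum_distrib_left mult_ac)

lemma transpose_eq_iff_sym:
  assumes "X \<in> carrier_mat n n"
  shows "transpose_mat X = X \<longleftrightarrow> (\<forall>i<n. \<forall>j<n. X $$ (i, j) = X $$ (j, i))"
  using assms by (auto simp: mat_eq_iff)

text \<open>The feasible set in terms of entries, the form in which the dual certificate uses it.\<close>
lemma sdp_feasible_iff:
  "sdp_feasible n \<gamma> Z \<longleftrightarrow> Z \<in> carrier_mat n n \<and> (\<forall>i<n. \<forall>j<n. Z $$ (i, j) = Z $$ (j, i)) \<and>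
     (\<forall>x. 0 \<le> bilin n (\<lambda>i j. Z $$ (i, j)) x x) \<and>
     (\<forall>i<n. Z $$ (i, i) \<le> 1) \<and> (\<forall>i<n. \<forall>j<n. 0 \<le> Z $$ (i, j)) \<and>
     (\<Sum>i<n. Z $$ (i, i)) = \<gamma> * real n \<and> (\<Sum>i<n. \<Sum>j<n. Z $$ (i, j)) = (\<gamma> * real n)\<^sup>2"
proof (cases "Z \<in> carrier_mat n n")
  case False
  then show ?thesis by (simp add: sdp_feasible_def)
next
  case True
  have "psd_mat n Z \<longleftrightarrow> (\<forall>x. 0 \<le> bilin n (\<lambda>i j. Z $$ (i, j)) x x)"
  proof
    assume psd: "psd_mat n Z"
    show "\<forall>x. 0 \<le> bilin n (\<lambda>i j. Z $$ (i, j)) x x"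
    proof
      fix x :: "nat \<Rightarrow> real"
      have "bilin n (\<lambda>i j. Z $$ (i, j)) (\<lambda>i. vec n x $ i) (\<lambda>i. vec n x $ i) = bilin n (\<lambda>i j. Z $$ (i, j)) x x"
        by (rule bilin_cong) auto
      then show "0 \<le> bilin n (\<lambda>i j. Z $$ (i, j)) x x"
        using psd[unfolded psd_mat_def, rule_format, of "vec n x"] quadratic_form_eq_bilin[OF True, of "vec n x"]
        by simp
    qed
  qed (simp add: psd_mat_def quadratic_form_eq_bilin[OF True])
  moreover have "mat_inner (1\<^sub>m n) Z = (\<Sum>i<n. Z $$ (i, i))"
    by (subst mat_inner_eq_sum[OF _ True])
       (auto intro!: sum.cong simp: if_distrib[of "\<lambda>x. x * _"] cong: if_cong)
  moreover have "mat_inner (all_ones_mat n) Z = (\<Sum>i<n. \<Sum>j<n. Z $$ (i, j))"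
    by (subst mat_inner_eq_sum[OF _ True]) (auto simp: all_ones_mat_def intro!: sum.cong)
  ultimately show ?thesis
    using True by (simp add: sdp_feasible_def transpose_eq_iff_sym power_mult_distrib)
qed

definition planted_set :: "real vec \<Rightarrow> nat set" where
  "planted_set \<zeta> = {i. i < dim_vec \<zeta> \<and> \<zeta> $ i = 1}"

lemma planted_set_props:
  assumes "\<zeta> \<in> labelings n \<gamma>"
  shows "planted_set \<zeta> \<subseteq> {..<n}" and "real (card (planted_set \<zeta>)) = \<gamma> * real n"
    and "i < n \<Longrightarrow> \<zeta> $ i = of_bool (i \<in> planted_set \<zeta>)"
    and "i < n \<Longrightarrow> j < n \<Longrightarrow> outer_square \<zeta> $$ (i, j) = of_bool (i \<in> planted_set \<zeta>) * of_bool (j \<in> planted_set \<zeta>)"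
    and "outer_square \<zeta> \<in> carrier_mat n n"
proof -
  have \<zeta>: "dim_vec \<zeta> = n" "\<And>i. i < n \<Longrightarrow> \<zeta> $ i = 0 \<or> \<zeta> $ i = 1" "(\<Sum>i<n. \<zeta> $ i) = \<gamma> * real n"
    using assms by (auto simp: labelings_def)
  show sub: "planted_set \<zeta> \<subseteq> {..<n}" using \<zeta>(1) by (auto simp: planted_set_def)
  show ind: "\<zeta> $ i = of_bool (i \<in> planted_set \<zeta>)" if "i < n" for i
    using \<zeta>(1) \<zeta>(2)[of i] that by (auto simp: planted_set_def)
  have "(\<Sum>i<n. \<zeta> $ i) = (\<Sum>i<n. if i \<in> planted_set \<zeta> then 1 else 0)"
    by (intro sum.cong) (auto simp: ind)
  also have "\<dots> = real (card ({..<n} \<inter> planted_set \<zeta>))"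
    by (subst sum.inter_restrict[symmetric]) auto
  finally show "real (card (planted_set \<zeta>)) = \<gamma> * real n"
    using sub \<zeta>(3) by (simp add: Int_absorb1)
  show "outer_square \<zeta> $$ (i, j) = of_bool (i \<in> planted_set \<zeta>) * of_bool (j \<in> planted_set \<zeta>)"
    if "i < n" "j < n" for i j using that \<zeta>(1) by (simp add: outer_square_def ind)
  show "outer_square \<zeta> \<in> carrier_mat n n" using \<zeta>(1) by (simp add: outer_square_def)
qed

lemma planted_feasible:
  assumes "\<zeta> \<in> labelings n \<gamma>"
  shows "sdp_feasible n \<gamma> (outer_square \<zeta>)"
proof -
  note P = planted_set_props[OF assms]
  let ?C = "planted_set \<zeta>"
  have form: "(\<Sum>i<n. \<Sum>j<n. (of_bool (i \<in> ?C) * x i) * (of_bool (j \<in> ?C) * x j)) = (sum x ?C)\<^sup>2" for x :: "nat \<Rightarrow> real"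
    unfolding sum_product[symmetric] sum_indicator[OF P(1)] by (simp add: power2_eq_square)
  have "bilin n (\<lambda>i j. outer_square \<zeta> $$ (i, j)) x x = (sum x ?C)\<^sup>2" for x
    unfolding form[symmetric] bilin_def by (intro sum.cong) (auto simp: P(4))
  moreover have "(\<Sum>i<n. \<Sum>j<n. outer_square \<zeta> $$ (i, j)) = (\<gamma> * real n)\<^sup>2"
    using form[of "\<lambda>_. 1"] by (simp add: P(2,4))
  moreover have "(\<Sum>i<n. outer_square \<zeta> $$ (i, i)) = \<gamma> * real n"
    using sum_indicator[OF P(1), of "\<lambda>_. 1"] by (simp add: P(2,4))
  ultimately show ?thesis
    unfolding sdp_feasible_iff by (auto simp: P(4,5))
qed

definition planted_mean :: "real \<Rightarrow> real \<Rightarrow> real vec \<Rightarrow> nat \<Rightarrow> nat \<Rightarrow> real" where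
  "planted_mean \<mu>1 \<mu>2 \<zeta> i j = (if \<zeta> $ i = 1 \<and> \<zeta> $ j = 1 then \<mu>1 else \<mu>2)"

definition noise :: "real \<Rightarrow> real \<Rightarrow> real vec \<Rightarrow> real mat \<Rightarrow> nat \<Rightarrow> nat \<Rightarrow> real" where
  "noise \<mu>1 \<mu>2 \<zeta> X i j = (if i = j then 0 else X $$ (i, j) - planted_mean \<mu>1 \<mu>2 \<zeta> i j)"

text \<open>The dual certificate with \<open>lam = (\<mu>1 + \<mu>2) / 2\<close>, halfway between the mean densities: the expected row sums inside and
outside the cluster then clear the threshold by the same margin \<open>\<gamma> n (\<mu>1 - \<mu>2) / 2\<close>. The summand \<open>\<bar>\<mu>1\<bar>\<close> pays for
the missing diagonal entry in a row of the cluster, and \<open>\<bar>\<mu>2\<bar>\<close> for the zero diagonal in the quadratic form.\<close>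
lemma sdp_recovers_if_noise_small:
  fixes X :: "real mat" and \<zeta> :: "real vec" and \<mu>1 \<mu>2 r t \<eta> :: real
  defines "W \<equiv> noise \<mu>1 \<mu>2 \<zeta> X"
  assumes X: "X \<in> carrier_mat n n" "transpose_mat X = X" "\<And>i. i < n \<Longrightarrow> X $$ (i, i) = 0"
    and \<zeta>: "\<zeta> \<in> labelings n \<gamma>" and "0 < n" "0 < \<gamma>"
    and est: "sdp_estimator n \<gamma> Zhat"
    and "\<mu>2 \<le> \<mu>1" "0 \<le> t"
    and rows: "\<And>i. i < n \<Longrightarrow> \<bar>\<Sum>j\<in>planted_set \<zeta>. W i j\<bar> \<le> r"
    and net: "\<And>z. z \<in> lattice_net n \<Longrightarrow>
      \<bar>bilin n W (\<lambda>i. real_of_int (z i)) (\<lambda>i. real_of_int (z i))\<bar> \<le> t * (16 * real n)"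
    and gap: "r + \<eta> + \<bar>\<mu>1\<bar> \<le> \<gamma> * real n * (\<mu>1 - \<mu>2) / 2"
    and \<eta>: "2 * t + \<bar>\<mu>2\<bar> < \<eta>"
  shows "Zhat X = outer_square \<zeta>"
proof (rule ccontr)
  assume neq: "Zhat X \<noteq> outer_square \<zeta>"
  define C where "C = planted_set \<zeta>"
  define lam where "lam = (\<mu>1 + \<mu>2) / 2"
  note P = planted_set_props[OF \<zeta>, folded C_def]
  let ?A = "\<lambda>i j. X $$ (i, j)" and ?Z = "\<lambda>i j. Zhat X $$ (i, j)"
  have finC: "finite C" using P(1) finite_subset by blast
  have K: "real (card C) = \<gamma> * real n" "C \<noteq> {}"
    using P(2) \<open>0 < n\<close> \<open>0 < \<gamma>\<close> by auto
  have arg_max: "is_arg_max (mat_inner X) (sdp_feasible n \<gamma>) (Zhat X)"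
    using est X by (simp add: sdp_estimator_def)
  then have Zf: "sdp_feasible n \<gamma> (Zhat X)" by (simp add: is_arg_max_def)
  then have Zc: "Zhat X \<in> carrier_mat n n" by (simp add: sdp_feasible_def)
  have symX: "?A i j = ?A j i" if "i < n" "j < n" for i j
    using X(1,2) that by (simp add: transpose_eq_iff_sym)
  have W_eq: "?A i j = W i j + (if i = j then 0 else if i \<in> C \<and> j \<in> C then \<mu>1 else \<mu>2)"
    if "i < n" "j < n" for i j
    using that X(3) by (simp add: W_def noise_def planted_mean_def P(3))
  have W_sym: "W i j = W j i" if "i < n" "j < n" for i j
    using symX[OF that] by (auto simp: W_def noise_def planted_mean_def)
  have C_less: "i < n" if "i \<in> C" for i using P(1) that by auto
  have "0 \<le> mat_inner X (Zhat X) - mat_inner X (outer_square \<zeta>)"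
    using arg_max planted_feasible[OF \<zeta>] by (auto simp: is_arg_max_def not_less)
  moreover have "mat_inner X (outer_square \<zeta>) = (\<Sum>i\<in>C. \<Sum>j\<in>C. ?A i j)"
  proof -
    have "mat_inner X (outer_square \<zeta>)
        = (\<Sum>i<n. of_bool (i \<in> C) * (\<Sum>j<n. of_bool (j \<in> C) * ?A i j))"
      unfolding mat_inner_eq_sum[OF X(1) P(5)] sum_distrib_left
      by (intro sum.cong) (auto simp: P(4))
    then show ?thesis unfolding sum_indicator[OF P(1)] .
  qed
  ultimately have better: "(\<Sum>i\<in>C. \<Sum>j\<in>C. ?A i j) \<le> (\<Sum>i<n. \<Sum>j<n. ?A i j * ?Z i j)"
    by (simp add: mat_inner_eq_sum[OF X(1) Zc])
  have inside: "\<eta> + lam * real (card C) \<le> (\<Sum>j\<in>C. ?A i j)" if "i \<in> C" for i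
  proof -
    have "(\<Sum>j\<in>C. ?A i j) = (\<Sum>j\<in>C. W i j + (if i = j then 0 else \<mu>1))"
      using that C_less by (intro sum.cong) (auto simp: W_eq)
    also have "\<dots> = (\<Sum>j\<in>C. W i j) + (\<Sum>j\<in>C - {i}. \<mu>1)"
      using finC that by (simp add: sum.distrib sum.remove)
    also have "(\<Sum>j\<in>C - {i}. \<mu>1) = real (card C) * \<mu>1 - \<mu>1"
      using finC that by (simp add: card_Diff_singleton of_nat_diff Suc_leI card_gt_0_iff K(2) algebra_simps)
    finally show ?thesis
      using rows[OF C_less[OF that]] gap unfolding C_def[symmetric] lam_def K(1)
      by (simp add: abs_le_iff field_simps) argo
  qed
  have outside: "(\<Sum>j\<in>C. ?A i j) \<le> lam * real (card C)" if "i < n" "i \<notin> C" for i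
  proof -
    have "(\<Sum>j\<in>C. ?A i j) = (\<Sum>j\<in>C. W i j + \<mu>2)"
      using that C_less by (intro sum.cong) (auto simp: W_eq)
    also have "\<dots> = (\<Sum>j\<in>C. W i j) + real (card C) * \<mu>2"
      by (simp add: sum.distrib)
    finally show ?thesis
      using rows[OF that(1)] gap \<eta> \<open>0 \<le> t\<close> unfolding C_def[symmetric] lam_def K(1)
      by (simp add: abs_le_iff field_simps) argo
  qed
  have spec: "bilin n ?A x x < \<eta> * sqnorm n x + lam * (\<Sum>i<n. x i)\<^sup>2"
    if orth: "sum x C = 0" and pos: "sqnorm n x > 0" for x
  proof -
    define d where "d = (\<lambda>i. if i \<in> C then \<mu>1 else \<mu>2)"
    \<comment> \<open>the mean is constant plus a block on C, corrected on the diagonal; the block vanishes on vectors summing to zero over C\<close>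
    have "bilin n ?A x x = bilin n W x x + (\<Sum>i<n. \<Sum>j<n. \<mu>2 * (x i * x j))
        + (\<mu>1 - \<mu>2) * (\<Sum>i<n. \<Sum>j<n. (of_bool (i \<in> C) * x i) * (of_bool (j \<in> C) * x j))
        - (\<Sum>i<n. \<Sum>j<n. of_bool (i = j) * (d i * x i * x j))"
      unfolding bilin_def sum.distrib[symmetric] sum_subtractf[symmetric] sum_distrib_left
      by (intro sum.cong refl) (auto simp: W_eq d_def algebra_simps)
    moreover have "(\<Sum>i<n. \<Sum>j<n. \<mu>2 * (x i * x j)) = \<mu>2 * (\<Sum>i<n. x i)\<^sup>2"
      by (simp only: power2_eq_square sum_product) (simp only: sum_distrib_left)
    moreover have "(\<Sum>i<n. \<Sum>j<n. (of_bool (i \<in> C) * x i) * (of_bool (j \<in> C) * x j)) = 0"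
      unfolding sum_product[symmetric] sum_indicator[OF P(1)] orth by simp
    moreover have "(\<Sum>i<n. \<Sum>j<n. of_bool (i = j) * (d i * x i * x j)) = (\<Sum>i<n. d i * (x i)\<^sup>2)"
      by (intro sum.cong refl)
         (simp add: of_bool_def if_distrib[of "\<lambda>x. x * _"] power2_eq_square cong: if_cong)
    moreover have "- \<bar>\<mu>2\<bar> * sqnorm n x \<le> (\<Sum>i<n. d i * (x i)\<^sup>2)"
      unfolding sqnorm_def sum_distrib_left using \<open>\<mu>2 \<le> \<mu>1\<close>
      by (intro sum_mono mult_right_mono) (auto simp: d_def)
    moreover have "\<bar>bilin n W x x\<bar> \<le> 2 * t * sqnorm n x"
      by (rule quadratic_form_bound_from_net[OF W_sym net])
    moreover have "(2 * t + \<bar>\<mu>2\<bar>) * sqnorm n x < \<eta> * sqnorm n x"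
      using \<eta> pos by (rule mult_strict_right_mono)
    moreover have "\<mu>2 * (\<Sum>i<n. x i)\<^sup>2 \<le> lam * (\<Sum>i<n. x i)\<^sup>2"
      using \<open>\<mu>2 \<le> \<mu>1\<close> by (intro mult_right_mono) (auto simp: lam_def)
    ultimately show ?thesis by (simp add: distrib_right)
  qed
  have "?Z i j = of_bool (i \<in> C) * of_bool (j \<in> C)" if "i < n" "j < n" for i j
    by (rule dual_certificate_forces_planted[where C = C and A = ?A and n = n and eta = \<eta> and lam = lam])
       (use P(1) K symX inside outside spec better that Zf[unfolded sdp_feasible_iff] in auto)
  then have "Zhat X = outer_square \<zeta>"
    using Zc P(4,5) by (auto intro!: eq_matI)
  with neq show False ..
qed

section \<open>The noise is small with high probability\<close>

text \<open>A bilinear form in the noise is a linear form in the entries above the diagonal, with coefficients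
\<open>u i * v j + u j * v i\<close>.\<close>
lemma noise_form_tail:
  assumes model: "pdsm M A n \<mu>1 \<mu>2 \<tau> \<zeta>" and "0 < \<tau>" "0 < s" "0 < V"
    and V: "(\<Sum>(i, j)\<in>upper_pairs n. (u i * v j + u j * v i)\<^sup>2) \<le> V"
  shows "{\<omega>\<in>space M. s \<le> \<bar>bilin n (noise \<mu>1 \<mu>2 \<zeta> (A \<omega>)) u v\<bar>} \<in> sets M" (is ?sets)
    and "measure M {\<omega>\<in>space M. s \<le> \<bar>bilin n (noise \<mu>1 \<mu>2 \<zeta> (A \<omega>)) u v\<bar>}
      \<le> 2 * exp (- s\<^sup>2 / (2 * \<tau>\<^sup>2 * V))" (is ?meas)
proof -
  interpret prob_space M using model by (simp add: pdsm_def)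
  let ?X = "\<lambda>ij \<omega>. A \<omega> $$ ij" and ?m = "\<lambda>ij. planted_mean \<mu>1 \<mu>2 \<zeta> (fst ij) (snd ij)"
  let ?c = "\<lambda>ij. u (fst ij) * v (snd ij) + u (snd ij) * v (fst ij)"
  have indep: "indep_vars (\<lambda>_. borel) ?X (upper_pairs n)"
    using model by (simp add: pdsm_def upper_pairs_def)
  have normal: "distributed M lborel (?X ij) (normal_density (?m ij) \<tau>)" if "ij \<in> upper_pairs n" for ij
  proof -
    obtain i j where ij: "ij = (i, j)" by (cases ij)
    have "distributed M lborel (\<lambda>\<omega>. A \<omega> $$ (i, j))
        (normal_density (if \<zeta> $ i = 1 \<and> \<zeta> $ j = 1 then \<mu>1 else \<mu>2) \<tau>)"
      using model that unfolding pdsm_def upper_pairs_def ij by blast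
    then show ?thesis by (simp only: ij planted_mean_def fst_conv snd_conv)
  qed
  have c: "(\<Sum>ij\<in>upper_pairs n. (?c ij)\<^sup>2) \<le> V"
    using V by (simp add: case_prod_unfold)
  have form: "bilin n (noise \<mu>1 \<mu>2 \<zeta> (A \<omega>)) u v = (\<Sum>ij\<in>upper_pairs n. ?c ij * (?X ij \<omega> - ?m ij))"
    if "\<omega> \<in> space M" for \<omega>
  proof -
    have A: "A \<omega> \<in> carrier_mat n n" "transpose_mat (A \<omega>) = A \<omega>"
      using model that by (auto simp: pdsm_def)
    have "A \<omega> $$ (j, i) = A \<omega> $$ (i, j)" if "i < n" "j < n" for i j
      using A that by (simp add: transpose_eq_iff_sym)
    then show ?thesis
      unfolding bilin_def sum_square_upper_pairs
      by (auto simp: noise_def upper_pairs_def planted_mean_def algebra_simps intro!: sum.cong)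
  qed
  have eq: "{\<omega>\<in>space M. s \<le> \<bar>bilin n (noise \<mu>1 \<mu>2 \<zeta> (A \<omega>)) u v\<bar>}
      = {\<omega>\<in>space M. s \<le> \<bar>\<Sum>ij\<in>upper_pairs n. ?c ij * (?X ij \<omega> - ?m ij)\<bar>}"
    by (rule Collect_cong) (auto simp: form)
  show ?sets unfolding eq
    by (rule normal_linear_form_abs_tail(1)[OF finite_upper_pairs indep normal \<open>0 < \<tau>\<close> c \<open>0 < V\<close> \<open>0 < s\<close>])
  show ?meas unfolding eq
    by (rule normal_linear_form_abs_tail(2)[OF finite_upper_pairs indep normal \<open>0 < \<tau>\<close> c \<open>0 < V\<close> \<open>0 < s\<close>])
qed

text \<open>Union bound over the \<open>n\<close> rows and the points of the net. Row sums and quadratic forms are both values of the bilinear form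
of the noise: at a unit vector and the cluster indicator, of variance at most \<open>\<tau>\<^sup>2 \<gamma> n\<close>, and at a net point taken
twice, of variance at most \<open>2 * \<tau>\<^sup>2 * (16 * n)\<^sup>2\<close>.\<close>
lemma pdsm_noise_small:
  assumes model: "pdsm M A n \<mu>1 \<mu>2 \<tau> \<zeta>" and \<zeta>: "\<zeta> \<in> labelings n \<gamma>"
    and pos: "0 < n" "0 < \<gamma>" "0 < \<tau>" "0 < r" "0 < t"
  obtains B where "B \<in> sets M"
    and "measure M B \<le> real n * (2 * exp (- r\<^sup>2 / (2 * \<tau>\<^sup>2 * (\<gamma> * real n))))
      + 2 ^ (16 * n) * 3 ^ n * (2 * exp (- t\<^sup>2 / (4 * \<tau>\<^sup>2)))"
    and "\<And>\<omega> i. \<omega> \<in> space M - B \<Longrightarrow> i < n \<Longrightarrow>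
      \<bar>\<Sum>j\<in>planted_set \<zeta>. noise \<mu>1 \<mu>2 \<zeta> (A \<omega>) i j\<bar> \<le> r"
    and "\<And>\<omega> z. \<omega> \<in> space M - B \<Longrightarrow> z \<in> lattice_net n \<Longrightarrow>
      \<bar>bilin n (noise \<mu>1 \<mu>2 \<zeta> (A \<omega>)) (\<lambda>i. real_of_int (z i)) (\<lambda>i. real_of_int (z i))\<bar> \<le> t * (16 * real n)"
proof -
  interpret prob_space M using model by (simp add: pdsm_def)
  define C where "C = planted_set \<zeta>"
  note P = planted_set_props[OF \<zeta>, folded C_def]
  let ?W = "\<lambda>\<omega>. noise \<mu>1 \<mu>2 \<zeta> (A \<omega>)"
  define R where "R = (\<lambda>k. {\<omega>\<in>space M. r \<le> \<bar>bilin n (?W \<omega>) (\<lambda>i. of_bool (i = k)) (\<lambda>i. of_bool (i \<in> C))\<bar>})"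
  define N where "N = (\<lambda>z. {\<omega>\<in>space M. t * (16 * real n) \<le>
      \<bar>bilin n (?W \<omega>) (\<lambda>i. real_of_int (z i)) (\<lambda>i. real_of_int (z i))\<bar>})"
  have row: "bilin n W (\<lambda>i. of_bool (i = k)) (\<lambda>i. of_bool (i \<in> C)) = (\<Sum>j\<in>C. W k j)" if "k < n" for W k
  proof -
    have "bilin n W (\<lambda>i. of_bool (i = k)) (\<lambda>i. of_bool (i \<in> C))
        = (\<Sum>i<n. of_bool (i \<in> {k}) * (\<Sum>j<n. of_bool (j \<in> C) * W i j))"
      unfolding bilin_def sum_distrib_left by (intro sum.cong) auto
    then show ?thesis using that sum_indicator[of "{k}" n] sum_indicator[OF P(1)] by simp
  qed
  have Rv: "(\<Sum>(i, j)\<in>upper_pairs n. (of_bool (i = k) * of_bool (j \<in> C) + of_bool (j = k) * of_bool (i \<in> C))\<^sup>2)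
      \<le> \<gamma> * real n" if "k < n" for k
  proof -
    let ?f = "\<lambda>i j. of_bool (i = k) * of_bool (j \<in> C) :: real"
    \<comment> \<open>off the diagonal at most one of the two summands is nonzero, so squaring does nothing; a factor of two lost here would move the threshold\<close>
    have "(\<Sum>(i, j)\<in>upper_pairs n. (?f i j + ?f j i)\<^sup>2) = (\<Sum>(i, j)\<in>upper_pairs n. ?f i j + ?f j i)"
      by (intro sum.cong) (auto simp: upper_pairs_def)
    also have "\<dots> \<le> (\<Sum>i<n. \<Sum>j<n. ?f i j)"
      unfolding sum_square_upper_pairs by (simp add: sum_nonneg)
    also have "\<dots> = \<gamma> * real n"
      using row[OF that, of "\<lambda>_ _. 1"] by (simp add: bilin_def P(2))
    finally show ?thesis .
  qed
  have R: "R k \<in> events" "prob (R k) \<le> 2 * exp (- r\<^sup>2 / (2 * \<tau>\<^sup>2 * (\<gamma> * real n)))" if "k < n" for k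
  proof -
    have "0 < \<gamma> * real n" using pos by simp
    then show "R k \<in> events" "prob (R k) \<le> 2 * exp (- r\<^sup>2 / (2 * \<tau>\<^sup>2 * (\<gamma> * real n)))"
      unfolding R_def using noise_form_tail[OF model \<open>0 < \<tau>\<close> \<open>0 < r\<close> _ Rv[OF that]] by blast+
  qed
  have Nv: "(\<Sum>(i, j)\<in>upper_pairs n. (real_of_int (z i) * real_of_int (z j) + real_of_int (z j) * real_of_int (z i))\<^sup>2)
      \<le> 2 * (16 * real n)\<^sup>2" if "z \<in> lattice_net n" for z
  proof -
    let ?f = "\<lambda>i j. 2 * ((real_of_int (z i))\<^sup>2 * (real_of_int (z j))\<^sup>2)"
    have "(\<Sum>(i, j)\<in>upper_pairs n. (real_of_int (z i) * real_of_int (z j) + real_of_int (z j) * real_of_int (z i))\<^sup>2)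
        = (\<Sum>(i, j)\<in>upper_pairs n. ?f i j + ?f j i)"
      by (intro sum.cong) (auto simp: power2_eq_square algebra_simps)
    also have "\<dots> \<le> (\<Sum>i<n. \<Sum>j<n. ?f i j)"
      unfolding sum_square_upper_pairs by (simp add: sum_nonneg)
    also have "\<dots> = 2 * (sqnorm n (\<lambda>i. real_of_int (z i)))\<^sup>2"
      by (simp only: sqnorm_def power2_eq_square[of "sum _ _"] sum_product) (simp only: sum_distrib_left)
    also have "\<dots> \<le> 2 * (16 * real n)\<^sup>2"
      using sqnorm_lattice_net_le[OF that] sqnorm_nonneg by (intro mult_left_mono power_mono) auto
    finally show ?thesis .
  qed
  have N: "N z \<in> events" "prob (N z) \<le> 2 * exp (- t\<^sup>2 / (4 * \<tau>\<^sup>2))" if "z \<in> lattice_net n" for z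
  proof -
    have "- (t * (16 * real n))\<^sup>2 / (2 * \<tau>\<^sup>2 * (2 * (16 * real n)\<^sup>2)) = - t\<^sup>2 / (4 * \<tau>\<^sup>2)"
      using pos by (simp add: field_simps power2_eq_square)
    moreover have "0 < t * (16 * real n)" "0 < 2 * (16 * real n)\<^sup>2" using pos by auto
    ultimately show "N z \<in> events" "prob (N z) \<le> 2 * exp (- t\<^sup>2 / (4 * \<tau>\<^sup>2))"
      unfolding N_def
      using noise_form_tail[OF model \<open>0 < \<tau>\<close> _ _ Nv[OF that], of "t * (16 * real n)"] by metis+
  qed
  let ?B = "(\<Union>k<n. R k) \<union> (\<Union>z\<in>lattice_net n. N z)"
  show ?thesis
  proof (rule that[of ?B])
    have RN: "(\<Union>k<n. R k) \<in> events" "(\<Union>z\<in>lattice_net n. N z) \<in> events"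
      using R(1) N(1) lattice_net_card(1) by (auto intro!: sets.finite_UN)
    then show "?B \<in> events" by blast
    have "prob ?B \<le> prob (\<Union>k<n. R k) + prob (\<Union>z\<in>lattice_net n. N z)"
      by (rule measure_Un_le) (rule RN)+
    also have "prob (\<Union>k<n. R k) \<le> (\<Sum>k<n. prob (R k))"
      using R(1) by (intro measure_UNION_le) auto
    also have "\<dots> \<le> (\<Sum>k<n. 2 * exp (- r\<^sup>2 / (2 * \<tau>\<^sup>2 * (\<gamma> * real n))))"
      using R(2) by (intro sum_mono) auto
    also have "prob (\<Union>z\<in>lattice_net n. N z) \<le> (\<Sum>z\<in>lattice_net n. prob (N z))"
      using N(1) lattice_net_card(1) by (intro measure_UNION_le) auto
    also have "\<dots> \<le> (\<Sum>z\<in>lattice_net n. 2 * exp (- t\<^sup>2 / (4 * \<tau>\<^sup>2)))"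
      using N(2) by (intro sum_mono) auto
    also have "\<dots> \<le> 2 ^ (16 * n) * 3 ^ n * (2 * exp (- t\<^sup>2 / (4 * \<tau>\<^sup>2)))"
      unfolding sum_constant by (intro mult_right_mono lattice_net_card(2)) auto
    finally show "prob ?B \<le> real n * (2 * exp (- r\<^sup>2 / (2 * \<tau>\<^sup>2 * (\<gamma> * real n))))
        + 2 ^ (16 * n) * 3 ^ n * (2 * exp (- t\<^sup>2 / (4 * \<tau>\<^sup>2)))" by simp
  next
    fix \<omega> i assume "\<omega> \<in> space M - ?B" "i < n"
    then have "\<omega> \<in> space M" "\<omega> \<notin> R i" by auto
    then show "\<bar>\<Sum>j\<in>planted_set \<zeta>. ?W \<omega> i j\<bar> \<le> r"
      using row[OF \<open>i < n\<close>] by (simp add: R_def C_def)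
  next
    fix \<omega> z assume "\<omega> \<in> space M - ?B" "z \<in> lattice_net n"
    then have "\<omega> \<in> space M" "\<omega> \<notin> N z" by auto
    then show "\<bar>bilin n (?W \<omega>) (\<lambda>i. real_of_int (z i)) (\<lambda>i. real_of_int (z i))\<bar> \<le> t * (16 * real n)"
      by (simp add: N_def)
  qed
qed

section \<open>Exact recovery\<close>

lemma finite_labelings: "finite (labelings n \<gamma>)"
proof (rule inj_on_finite)
  show "inj_on planted_set (labelings n \<gamma>)"
  proof (rule inj_onI)
    fix \<zeta> \<xi>
    assume lab: "\<zeta> \<in> labelings n \<gamma>" "\<xi> \<in> labelings n \<gamma>" and eq: "planted_set \<zeta> = planted_set \<xi>"
    have "dim_vec \<zeta> = n" "dim_vec \<xi> = n" using lab by (auto simp: labelings_def)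
    moreover have "\<zeta> $ i = \<xi> $ i" if "i < n" for i
      using planted_set_props(3)[OF lab(1) that] planted_set_props(3)[OF lab(2) that] eq by simp
    ultimately show "\<zeta> = \<xi>" by (intro eq_vecI) auto
  qed
  show "planted_set ` labelings n \<gamma> \<subseteq> Pow {..<n}" using planted_set_props(1) by blast
qed simp

lemma labelings_nonempty:
  assumes "n \<in> admissible_sizes \<gamma>" "0 < \<gamma>" "\<gamma> < 1"
  shows "labelings n \<gamma> \<noteq> {}"
proof -
  obtain k :: int where k: "\<gamma> * real n = of_int k"
    using assms(1) by (auto simp: admissible_sizes_def elim: Ints_cases)
  have "0 \<le> \<gamma> * real n" "\<gamma> * real n \<le> real n"
    using assms by (auto simp: mult_left_le_one_le)
  then have k': "0 \<le> k" "k \<le> int n" unfolding k by linarith+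
  have "(\<Sum>i<n. if i \<in> {..<nat k} then 1 else 0) = real (card ({..<n} \<inter> {..<nat k}))"
    by (subst sum.inter_restrict[symmetric]) auto
  also have "{..<n} \<inter> {..<nat k} = {..<nat k}" using k' by auto
  finally have "vec n (\<lambda>i. if i \<in> {..<nat k} then 1 else 0) \<in> labelings n \<gamma>"
    using k k' by (simp add: labelings_def)
  then show ?thesis by blast
qed

text \<open>The first term is \<open>2 * n powr (1 - p)\<close> with \<open>p = a\<^sup>2 / (2 * \<tau>\<^sup>2 * \<gamma>) > 1\<close>. In the second, the size of the net is
exponential in \<open>n\<close> and is beaten by \<open>exp (- q * n * ln n)\<close> for every \<open>q > 0\<close>.\<close>
lemma failure_bound_tendsto_0:
  fixes \<gamma> \<tau> a b :: real
  assumes pos: "0 < \<gamma>" "0 < \<tau>" "0 < b" and a: "0 < a" "2 * \<tau>\<^sup>2 * \<gamma> < a\<^sup>2"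
  defines "g \<equiv> \<lambda>n. sqrt (real n * ln (real n))"
  shows "(\<lambda>n. real n * (2 * exp (- (a * g n)\<^sup>2 / (2 * \<tau>\<^sup>2 * (\<gamma> * real n))))
      + 2 ^ (16 * n) * 3 ^ n * (2 * exp (- (b * g n)\<^sup>2 / (4 * \<tau>\<^sup>2)))) \<longlonglongrightarrow> 0"
proof -
  define p where "p = a\<^sup>2 / (2 * \<tau>\<^sup>2 * \<gamma>)"
  define q where "q = b\<^sup>2 / (4 * \<tau>\<^sup>2)"
  have p: "p > 1" using pos a by (simp add: p_def)
  have q: "q > 0" using pos by (simp add: q_def)
  have "(\<lambda>n. real n * (2 * exp (- p * ln (real n)))) \<longlonglongrightarrow> 0"
    using p by real_asymp
  moreover have "(\<lambda>n. 2 * exp (real n * (16 * ln 2 + ln 3) - q * (real n * ln (real n)))) \<longlonglongrightarrow> 0"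
    using q by real_asymp
  ultimately have "(\<lambda>n. real n * (2 * exp (- p * ln (real n)))
      + 2 * exp (real n * (16 * ln 2 + ln 3) - q * (real n * ln (real n)))) \<longlonglongrightarrow> 0 + 0"
    by (rule tendsto_add)
  then show ?thesis
  proof (rule Lim_transform_eventually[THEN tendsto_eq_rhs])
    show "eventually (\<lambda>n. real n * (2 * exp (- p * ln (real n)))
        + 2 * exp (real n * (16 * ln 2 + ln 3) - q * (real n * ln (real n)))
        = real n * (2 * exp (- (a * g n)\<^sup>2 / (2 * \<tau>\<^sup>2 * (\<gamma> * real n))))
        + 2 ^ (16 * n) * 3 ^ n * (2 * exp (- (b * g n)\<^sup>2 / (4 * \<tau>\<^sup>2)))) sequentially"
      using eventually_gt_at_top[of 0]
    proof eventually_elim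
      case (elim n)
      then have g2: "(g n)\<^sup>2 = real n * ln (real n)" by (simp add: g_def)
      have "- (a * g n)\<^sup>2 / (2 * \<tau>\<^sup>2 * (\<gamma> * real n)) = - p * ln (real n)"
        using elim pos by (simp add: power_mult_distrib g2 p_def field_simps)
      moreover have "- (b * g n)\<^sup>2 / (4 * \<tau>\<^sup>2) = - (q * (real n * ln (real n)))"
        using pos by (simp add: power_mult_distrib g2 q_def field_simps)
      moreover have "2 ^ (16 * n) * 3 ^ n = exp (real n * (16 * ln 2 + ln 3))"
      proof -
        have "exp (real n * (16 * ln 2 + ln 3)) = exp (real (16 * n) * ln 2) * exp (real n * ln 3)"
          by (simp add: exp_add[symmetric] algebra_simps)
        then show ?thesis by (simp only: exp_of_nat_mult) simp
      qed
      ultimately show ?case by (simp add: exp_diff exp_minus field_simps)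
    qed
  qed simp
qed

text \<open>With \<open>h = \<gamma> (\<alpha> - \<beta>) / 2\<close>, the half gap of the row means is \<open>h g\<close>, and \<open>\<gamma> SNR > 1\<close> says
\<open>2 \<tau>\<^sup>2 \<gamma> < h\<^sup>2\<close>. The level \<open>a g\<close> for the row noise lies strictly in between. The remaining room \<open>(h - a) g\<close> is split into
two equal shares \<open>e g\<close>, one for the spectral slack \<open>\<eta>\<close> and one for the bounded term \<open>\<bar>\<mu>1\<bar>\<close>; half of \<open>\<eta>\<close>
absorbs the noise form and the other half \<open>\<bar>\<mu>2\<bar>\<close>.\<close>
theorem theorem27:
  fixes \<gamma> \<alpha> \<beta> \<tau> :: real
    and M :: "nat \<Rightarrow> real mat \<Rightarrow> 'a measure"
    and A :: "nat \<Rightarrow> real mat \<Rightarrow> 'a \<Rightarrow> real mat"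
    and Zhat :: "nat \<Rightarrow> real mat \<Rightarrow> real mat"
  assumes "0 < \<gamma>" and "\<gamma> < 1"
    and "\<beta> < \<alpha>"
    and "0 < \<tau>"
    and model: "\<And>n \<zeta>. n \<in> admissible_sizes \<gamma> \<Longrightarrow> \<zeta> \<in> labelings n \<gamma> \<Longrightarrow>
          pdsm (M n (outer_square \<zeta>)) (A n (outer_square \<zeta>)) n
            (\<alpha> * sqrt (ln (real n) / real n)) (\<beta> * sqrt (ln (real n) / real n)) \<tau> \<zeta>"
    and estimator: "\<And>n. n \<in> admissible_sizes \<gamma> \<Longrightarrow> sdp_estimator n \<gamma> (Zhat n)"
    and event: "\<And>n Z. n \<in> admissible_sizes \<gamma> \<Longrightarrow> Z \<in> cluster_matrices n \<gamma> \<Longrightarrow>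
          {\<omega> \<in> space (M n Z). Zhat n (A n Z \<omega>) = Z} \<in> sets (M n Z)"
    and "\<gamma> * snr \<alpha> \<beta> \<tau> > 1"
  shows "((\<lambda>n. MIN Z\<in>cluster_matrices n \<gamma>.
             measure (M n Z) {\<omega> \<in> space (M n Z). Zhat n (A n Z \<omega>) = Z}) \<longlongrightarrow> 1)
          (inf sequentially (principal (admissible_sizes \<gamma>)))"
proof -
  define h where "h = \<gamma> * (\<alpha> - \<beta>) / 2"
  define g where "g = (\<lambda>n::nat. sqrt (real n * ln (real n)))"
  have h: "0 < h" using assms(1,3) by (simp add: h_def)
  have "2 * \<tau>\<^sup>2 * \<gamma> < h\<^sup>2"
  proof -
    have "8 * \<tau>\<^sup>2 < \<gamma> * (\<alpha> - \<beta>)\<^sup>2"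
      using \<open>\<gamma> * snr \<alpha> \<beta> \<tau> > 1\<close> \<open>0 < \<tau>\<close> by (simp add: snr_def field_simps)
    then have "\<gamma> / 4 * (8 * \<tau>\<^sup>2) < \<gamma> / 4 * (\<gamma> * (\<alpha> - \<beta>)\<^sup>2)"
      using \<open>0 < \<gamma>\<close> by (intro mult_strict_left_mono) auto
    then show ?thesis by (simp add: h_def power2_eq_square field_simps)
  qed
  then have "sqrt (2 * \<tau>\<^sup>2 * \<gamma>) < h" using h by (intro real_less_lsqrt) auto
  then obtain a where a: "sqrt (2 * \<tau>\<^sup>2 * \<gamma>) < a" "a < h" using dense by blast
  have "0 \<le> sqrt (2 * \<tau>\<^sup>2 * \<gamma>)" using \<open>0 < \<gamma>\<close> by simp
  then have a0: "0 < a" using a(1) by linarith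
  have a2: "2 * \<tau>\<^sup>2 * \<gamma> < a\<^sup>2" using a(1) real_le_rsqrt[of a "2 * \<tau>\<^sup>2 * \<gamma>"] by linarith
  define e where "e = (h - a) / 2"
  have e: "0 < e" using a by (simp add: e_def)
  define \<delta> where "\<delta> = (\<lambda>n. real n * (2 * exp (- (a * g n)\<^sup>2 / (2 * \<tau>\<^sup>2 * (\<gamma> * real n))))
      + 2 ^ (16 * n) * 3 ^ n * (2 * exp (- (e / 4 * g n)\<^sup>2 / (4 * \<tau>\<^sup>2))))"
  have \<delta>: "\<delta> \<longlonglongrightarrow> 0"
    unfolding \<delta>_def g_def using \<open>0 < \<gamma>\<close> \<open>0 < \<tau>\<close> e a0 a2 by (intro failure_bound_tendsto_0) auto
  have recovery: "1 - \<delta> n \<le> measure (M n Z) {\<omega> \<in> space (M n Z). Zhat n (A n Z \<omega>) = Z}"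
    if n: "n \<in> admissible_sizes \<gamma>" "3 \<le> n" and large: "\<bar>\<alpha>\<bar> \<le> e * g n" "\<bar>\<beta>\<bar> < e / 2 * g n"
      and Z: "Z \<in> cluster_matrices n \<gamma>" for n Z
  proof -
    obtain \<zeta> where \<zeta>: "\<zeta> \<in> labelings n \<gamma>" and Z_eq: "Z = outer_square \<zeta>"
      using Z by (auto simp: cluster_matrices_def)
    define s where "s = sqrt (ln (real n) / real n)"
    define \<mu>1 where "\<mu>1 = \<alpha> * s"
    define \<mu>2 where "\<mu>2 = \<beta> * s"
    have n0: "0 < n" "0 < real n" "0 < ln (real n)" using n(2) by (auto simp: ln_gt_zero)
    have "ln (real n) \<le> real n" using ln_less_self[OF n0(2)] by simp
    then have s: "0 \<le> s" "s \<le> 1" using n0 by (simp_all add: s_def)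
    have ns: "real n * s = g n"
    proof -
      have "real n * s = (real n / sqrt (real n)) * sqrt (ln (real n))"
        unfolding s_def real_sqrt_divide by simp
      also have "real n / sqrt (real n) = sqrt (real n)" by (rule real_div_sqrt) simp
      finally show ?thesis by (simp add: g_def real_sqrt_mult)
    qed
    have g: "0 < g n" using n0 by (simp add: g_def)
    have pdsm: "pdsm (M n Z) (A n Z) n \<mu>1 \<mu>2 \<tau> \<zeta>"
      using model[OF n(1) \<zeta>] by (simp add: Z_eq \<mu>1_def \<mu>2_def s_def)
    then interpret prob_space "M n Z" by (simp add: pdsm_def)
    let ?T = "{\<omega> \<in> space (M n Z). Zhat n (A n Z \<omega>) = Z}"
    obtain B where B: "B \<in> events" "prob B \<le> \<delta> n"
      "\<And>\<omega> i. \<omega> \<in> space (M n Z) - B \<Longrightarrow> i < n \<Longrightarrow>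
        \<bar>\<Sum>j\<in>planted_set \<zeta>. noise \<mu>1 \<mu>2 \<zeta> (A n Z \<omega>) i j\<bar> \<le> a * g n"
      "\<And>\<omega> z. \<omega> \<in> space (M n Z) - B \<Longrightarrow> z \<in> lattice_net n \<Longrightarrow>
        \<bar>bilin n (noise \<mu>1 \<mu>2 \<zeta> (A n Z \<omega>)) (\<lambda>i. real_of_int (z i)) (\<lambda>i. real_of_int (z i))\<bar>
          \<le> e / 4 * g n * (16 * real n)"
      using pdsm_noise_small[OF pdsm \<zeta> n0(1) \<open>0 < \<gamma>\<close> \<open>0 < \<tau>\<close>, of "a * g n" "e / 4 * g n"] a0 e g
      unfolding \<delta>_def by auto
    have abs_le: "\<bar>c * s\<bar> \<le> \<bar>c\<bar>" for c
      using s by (simp add: abs_mult mult_left_le)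
    have gap: "a * g n + e * g n + \<bar>\<mu>1\<bar> \<le> \<gamma> * real n * (\<mu>1 - \<mu>2) / 2"
    proof -
      have "\<gamma> * real n * (\<mu>1 - \<mu>2) / 2 = h * (real n * s)"
        by (simp add: \<mu>1_def \<mu>2_def h_def algebra_simps)
      also have "\<dots> = a * g n + e * g n + e * g n"
        unfolding ns by (simp add: e_def field_simps)
      finally show ?thesis using abs_le[of \<alpha>] large(1) by (simp add: \<mu>1_def)
    qed
    have \<eta>: "2 * (e / 4 * g n) + \<bar>\<mu>2\<bar> < e * g n"
      using abs_le[of \<beta>] large(2) by (simp add: \<mu>2_def)
    have "space (M n Z) - ?T \<subseteq> B"
    proof
      fix \<omega> assume \<omega>: "\<omega> \<in> space (M n Z) - ?T"
      show "\<omega> \<in> B"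
      proof (rule ccontr)
        assume "\<omega> \<notin> B"
        then have good: "\<omega> \<in> space (M n Z) - B" using \<omega> by simp
        have X: "A n Z \<omega> \<in> carrier_mat n n" "transpose_mat (A n Z \<omega>) = A n Z \<omega>"
          "\<And>i. i < n \<Longrightarrow> A n Z \<omega> $$ (i, i) = 0"
          using pdsm good by (auto simp: pdsm_def)
        have "\<mu>2 \<le> \<mu>1" using \<open>\<beta> < \<alpha>\<close> s by (simp add: \<mu>1_def \<mu>2_def mult_right_mono)
        moreover have "0 \<le> e / 4 * g n" using e g by simp
        ultimately have "Zhat n (A n Z \<omega>) = outer_square \<zeta>"
          using sdp_recovers_if_noise_small[OF X \<zeta> n0(1) \<open>0 < \<gamma>\<close> estimator[OF n(1)] _ _
              B(3)[OF good] B(4)[OF good] gap \<eta>] by blast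
        then show False using \<omega> by (simp add: Z_eq)
      qed
    qed
    then have "prob (space (M n Z) - ?T) \<le> prob B" by (rule finite_measure_mono) (rule B(1))
    moreover have "prob (space (M n Z) - ?T) = 1 - prob ?T" by (rule prob_compl) (rule event[OF n(1) Z])
    ultimately show ?thesis using B(2) by linarith
  qed
  have "filterlim g at_top sequentially" unfolding g_def by real_asymp
  then have g_large: "eventually (\<lambda>n. c \<le> g n) sequentially" for c
    by (simp add: filterlim_at_top)
  have "eventually (\<lambda>n. 3 \<le> n \<and> \<bar>\<alpha>\<bar> \<le> e * g n \<and> \<bar>\<beta>\<bar> < e / 2 * g n) sequentially"
    using eventually_ge_at_top[of 3] g_large[of "\<bar>\<alpha>\<bar> / e"] g_large[of "(2 * \<bar>\<beta>\<bar> + 1) / e"]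
    by eventually_elim (use e in \<open>auto simp: field_simps\<close>)
  then have ev: "eventually (\<lambda>n. n \<in> admissible_sizes \<gamma> \<and> 3 \<le> n \<and> \<bar>\<alpha>\<bar> \<le> e * g n \<and> \<bar>\<beta>\<bar> < e / 2 * g n)
      (inf sequentially (principal (admissible_sizes \<gamma>)))"
    unfolding eventually_inf_principal by eventually_elim auto
  let ?p = "\<lambda>n Z. measure (M n Z) {\<omega> \<in> space (M n Z). Zhat n (A n Z \<omega>) = Z}"
  have fin: "finite (cluster_matrices n \<gamma>)" for n
    by (simp add: cluster_matrices_def finite_labelings)
  have ne: "cluster_matrices n \<gamma> \<noteq> {}" if "n \<in> admissible_sizes \<gamma>" for n
    using labelings_nonempty[OF that \<open>0 < \<gamma>\<close> \<open>\<gamma> < 1\<close>] by (simp add: cluster_matrices_def)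
  show ?thesis
  proof (rule tendsto_sandwich)
    show "eventually (\<lambda>n. 1 - \<delta> n \<le> (MIN Z\<in>cluster_matrices n \<gamma>. ?p n Z))
        (inf sequentially (principal (admissible_sizes \<gamma>)))"
      using ev by eventually_elim (use fin ne recovery in simp)
    show "eventually (\<lambda>n. (MIN Z\<in>cluster_matrices n \<gamma>. ?p n Z) \<le> 1)
        (inf sequentially (principal (admissible_sizes \<gamma>)))"
      using ev
    proof eventually_elim
      case (elim n)
      then obtain Z where Z: "Z \<in> cluster_matrices n \<gamma>" using ne by blast
      then obtain \<zeta> where "\<zeta> \<in> labelings n \<gamma>" "Z = outer_square \<zeta>"
        by (auto simp: cluster_matrices_def)
      then interpret prob_space "M n Z" using model elim by (auto simp: pdsm_def)
      have "(MIN Z\<in>cluster_matrices n \<gamma>. ?p n Z) \<le> ?p n Z"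
        using fin Z by (intro Min_le) auto
      then show ?case using prob_le_1 order_trans by blast
    qed
    have "(\<lambda>n. 1 - \<delta> n) \<longlonglongrightarrow> 1 - 0" by (intro tendsto_intros \<delta>)
    then show "((\<lambda>n. 1 - \<delta> n) \<longlongrightarrow> 1) (inf sequentially (principal (admissible_sizes \<gamma>)))"
      by (intro tendsto_mono[OF inf_le1]) simp
  qed simp
qed

end
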